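(* For any $\varepsilon > 0$ there exists $d^* > 0$ such that for any $d \ge d^*$ and any $\eta > 0$ there exist $n^* > 0$, $D > 0$, $\gamma \ge 1$, and $C > 0$ (depending on $\varepsilon, d, \eta$) such that the following holds for all $n \ge n^*$. For $k = (1-\varepsilon)\frac{\log d}{d} n$ and $\delta = \exp(-C n^{1/3})$, there exists a deterministic degree-$D$ polynomial $f:\mathbb{R}^m\to\mathbb{R}^n$ that $(k,\delta,\gamma,\eta)$-optimizes the independent set problem in $G(n,d/n)$.
   Context: Let $m = \binom{n}{2}$. A graph on vertex set $[n]$ is encoded as $Y \in \{0,1\}^m$, each coordinate being the indicator of one of the $\binom n2$ possible edges. $Y \sim G(n,d/n)$ means the coordinates of $Y$ are i.i.d. Bernoulli$(d/n)$. A function $f:\mathbb{R}^m \to \mathbb{R}^n$ is a polynomial of degree (at most) $D$ if $f=(f_1,\dots,f_n)$ with each $f_i$ a real multivariate polynomial of degree at most $D$ (a deterministic polynomial is viewed as a random polynomial with trivial seed $\omega$). For $Y\in\{0,1\}^m$ and $\eta\ge 0$, define $V^\eta_f(Y)$: let $A = \{i : f_i(Y) \ge 1\}$, $\tilde A = \{i \in A : i \text{ has no neighbors in } A \text{ in the graph } Y\}$, $B = \{i : f_i(Y) \in (1/2,1)\}$; then $V^\eta_f(Y)=\tilde A$ if $|A\setminus \tilde A| + |B| \le \eta n$, and $V^\eta_f(Y)=\emptyset$ otherwise. For $k>0$, $\delta\in[0,1]$, $\gamma\ge 1$, $\eta>0$, $f$ is said to $(k,\delta,\gamma,\eta)$-optimize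 the independent set problem in $G(n,d/n)$ if, with $Y\sim G(n,d/n)$: $\mathbb{E}_{Y}[\|f(Y)\|^2] \le \gamma k$ and $\mathbb{P}_{Y}[|V^\eta_f(Y)| \ge k] \ge 1-\delta$. Here $\log$ is the natural logarithm. *)

theory Defs
  imports "HOL-Probability.Probability" "HOL-Library.Poly_Mapping"
begin

(* The n choose 2 coordinates of Y are indexed by the two-element subsets of {1..n}.  Vectors of
   R^m and R^n are functions on nat set and nat of which only the coordinates in vertex_pairs n
   and {1..n} matter. *)
definition vertex_pairs :: "nat \<Rightarrow> nat set set" where
  "vertex_pairs n = {e. e \<subseteq> {1..n} \<and> card e = 2}"

lemma card_vertex_pairs: "card (vertex_pairs n) = n choose 2"
  unfolding vertex_pairs_def by (simp add: n_subsets)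

(* The edge probability is meant to lie in [0,1]; bernoulli_pmf truncates it otherwise. *)
definition random_graph :: "nat \<Rightarrow> real \<Rightarrow> (nat set \<Rightarrow> real) pmf" where
  "random_graph n p = Pi_pmf (vertex_pairs n) 0 (\<lambda>_. map_pmf of_bool (bernoulli_pmf p))"

definition adjacent :: "(nat set \<Rightarrow> real) \<Rightarrow> nat \<Rightarrow> nat \<Rightarrow> bool" where
  "adjacent Y i j \<longleftrightarrow> i \<noteq> j \<and> Y {i, j} = 1"

(* A polynomial in variables indexed by 'v: finitely many monomials with their coefficients, a
   monomial being a finitely supported exponent function. *)
type_synonym 'v real_mpoly = "('v \<Rightarrow>\<^sub>0 nat) \<Rightarrow>\<^sub>0 real"

definition mpoly_eval :: "'v real_mpoly \<Rightarrow> ('v \<Rightarrow> real) \<Rightarrow> real" where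
  "mpoly_eval q x =
     (\<Sum>a\<in>Poly_Mapping.keys q. Poly_Mapping.lookup q a *
        (\<Prod>v\<in>Poly_Mapping.keys a. x v ^ Poly_Mapping.lookup a v))"

definition mpoly_vars :: "'v real_mpoly \<Rightarrow> 'v set" where
  "mpoly_vars q = (\<Union>a\<in>Poly_Mapping.keys q. Poly_Mapping.keys a)"

definition mpoly_degree_le :: "'v real_mpoly \<Rightarrow> nat \<Rightarrow> bool" where
  "mpoly_degree_le q D \<longleftrightarrow>
     (\<forall>a\<in>Poly_Mapping.keys q. (\<Sum>v\<in>Poly_Mapping.keys a. Poly_Mapping.lookup a v) \<le> D)"

definition polynomial_map :: "nat \<Rightarrow> nat \<Rightarrow> ((nat set \<Rightarrow> real) \<Rightarrow> nat \<Rightarrow> real) \<Rightarrow> bool" where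
  "polynomial_map n D f \<longleftrightarrow>
     (\<forall>i\<in>{1..n}. \<exists>q. mpoly_vars q \<subseteq> vertex_pairs n \<and> mpoly_degree_le q D \<and>
        (\<forall>x. f x i = mpoly_eval q x))"

definition rounded_set ::
    "nat \<Rightarrow> real \<Rightarrow> ((nat set \<Rightarrow> real) \<Rightarrow> nat \<Rightarrow> real) \<Rightarrow> (nat set \<Rightarrow> real) \<Rightarrow> nat set" where
  "rounded_set n \<eta> f Y =
     (let A = {i\<in>{1..n}. f Y i \<ge> 1};
          A' = {i\<in>A. \<not> (\<exists>j\<in>A. adjacent Y i j)};
          B = {i\<in>{1..n}. f Y i \<in> {1/2<..<1}}
      in if real (card (A - A') + card B) \<le> \<eta> * real n then A' else {})"

(* Meant for k > 0, 0 \<le> \<delta> \<le> 1, \<gamma> \<ge> 1 and \<eta> > 0. *)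
definition optimizes_independent_set ::
    "nat \<Rightarrow> real \<Rightarrow> ((nat set \<Rightarrow> real) \<Rightarrow> nat \<Rightarrow> real) \<Rightarrow> real \<Rightarrow> real \<Rightarrow> real \<Rightarrow> real \<Rightarrow> bool" where
  "optimizes_independent_set n d f k \<delta> \<gamma> \<eta> \<longleftrightarrow>
     measure_pmf.expectation (random_graph n (d / real n)) (\<lambda>Y. (L2_set (f Y) {1..n})\<^sup>2) \<le> \<gamma> * k \<and>
     measure_pmf.prob (random_graph n (d / real n))
       {Y. real (card (rounded_set n \<eta> f Y)) \<ge> k} \<ge> 1 - \<delta>"

end

theory Submission
  imports Defs "HOL-Real_Asymp.Real_Asymp"
begin

text \<open>Vertices are processed in \<open>R\<close> rounds, \<open>i\<close> in round \<open>i mod R\<close>, and \<open>i\<close> is selected if none of its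
neighbours from earlier rounds is.  Replacing ``no selected earlier neighbour'' by a polynomial that
is \<open>1\<close> at \<open>0\<close> and vanishes at \<open>1, \<dots>, M\<close> gives polynomials whose degree depends only on \<open>R\<close> and \<open>M\<close>;
they have the intended values away from the ball of radius \<open>R\<close> around the vertices of degree more
than \<open>M\<close>.  Selected vertices are adjacent only inside a round, and for large \<open>R\<close> few edges are of
this kind.  By Chernoff bounds and a union bound over all small vertex sets, the exceptional vertices
number at most \<open>b n\<close> for any prescribed \<open>b > 0\<close>, up to probability \<open>exp (- c n)\<close>.

No analysis of the greedy process is needed to bound the number of selected vertices from below:
together with the exceptional ones they form a dominating set, and a union bound shows that every
dominating set has at least \<open>(1 - \<epsilon> / 2) (ln d / d) n\<close> vertices: a given set of that size
misses each further vertex with probability about \<open>d powr (\<epsilon> / 2) / d\<close>, which for large \<open>d\<close> beats the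
number \<open>exp (O (ln d)\<^sup>2 n / d)\<close> of candidate sets.\<close>

subsection \<open>Polynomial functions\<close>

definition monomial_eval :: "('v \<Rightarrow>\<^sub>0 nat) \<Rightarrow> ('v \<Rightarrow> real) \<Rightarrow> real" where
  "monomial_eval a x = (\<Prod>v\<in>Poly_Mapping.keys a. x v ^ Poly_Mapping.lookup a v)"

lemma monomial_eval_superset:
  assumes "finite S" "Poly_Mapping.keys a \<subseteq> S"
  shows "monomial_eval a x = (\<Prod>v\<in>S. x v ^ Poly_Mapping.lookup a v)"
  unfolding monomial_eval_def using assms
  by (intro prod.mono_neutral_left) (auto simp: in_keys_iff)

lemma monomial_eval_add: "monomial_eval (a + b) x = monomial_eval a x * monomial_eval b x"
proof -
  let ?S = "Poly_Mapping.keys a \<union> Poly_Mapping.keys b"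
  have "Poly_Mapping.keys (a + b) \<subseteq> ?S" by (rule Poly_Mapping.keys_add)
  then show ?thesis
    by (simp add: monomial_eval_superset[of ?S] lookup_add power_add prod.distrib)
qed

definition monomial_degree :: "('v \<Rightarrow>\<^sub>0 nat) \<Rightarrow> nat" where
  "monomial_degree a = (\<Sum>v\<in>Poly_Mapping.keys a. Poly_Mapping.lookup a v)"

lemma monomial_degree_superset:
  assumes "finite S" "Poly_Mapping.keys a \<subseteq> S"
  shows "monomial_degree a = (\<Sum>v\<in>S. Poly_Mapping.lookup a v)"
  unfolding monomial_degree_def using assms
  by (intro sum.mono_neutral_left) (auto simp: in_keys_iff)

lemma monomial_degree_add: "monomial_degree (a + b) = monomial_degree a + monomial_degree b"
proof -
  let ?S = "Poly_Mapping.keys a \<union> Poly_Mapping.keys b"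
  have "Poly_Mapping.keys (a + b) \<subseteq> ?S" by (rule Poly_Mapping.keys_add)
  then show ?thesis
    by (simp add: monomial_degree_superset[of ?S] lookup_add sum.distrib)
qed

lemma mpoly_eval_superset:
  assumes "finite S" "Poly_Mapping.keys q \<subseteq> S"
  shows "mpoly_eval q x = (\<Sum>a\<in>S. Poly_Mapping.lookup q a * monomial_eval a x)"
  unfolding mpoly_eval_def monomial_eval_def using assms
  by (intro sum.mono_neutral_left) (auto simp: in_keys_iff)

lemma mpoly_eval_add: "mpoly_eval (p + q) x = mpoly_eval p x + mpoly_eval q x"
proof -
  let ?S = "Poly_Mapping.keys p \<union> Poly_Mapping.keys q"
  have "Poly_Mapping.keys (p + q) \<subseteq> ?S" by (rule Poly_Mapping.keys_add)
  then show ?thesis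
    by (simp add: mpoly_eval_superset[of ?S] lookup_add distrib_right sum.distrib)
qed

text \<open>One coordinate of a \<open>polynomial_map\<close>, with the variable set and the degree
  bound as parameters, so that the closure properties track both.\<close>

definition polynomial_function :: "'v set \<Rightarrow> nat \<Rightarrow> (('v \<Rightarrow> real) \<Rightarrow> real) \<Rightarrow> bool" where
  "polynomial_function V D g \<longleftrightarrow>
     (\<exists>q. mpoly_vars q \<subseteq> V \<and> mpoly_degree_le q D \<and> (\<forall>x. g x = mpoly_eval q x))"

lemma polynomial_function_mono:
  "polynomial_function V D g \<Longrightarrow> D \<le> D' \<Longrightarrow> polynomial_function V D' g"
  unfolding polynomial_function_def mpoly_degree_le_def by (meson order_trans)

lemma polynomial_function_monomial:
  assumes "Poly_Mapping.keys a \<subseteq> V" "monomial_degree a \<le> D"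
  shows "polynomial_function V D (\<lambda>x. c * monomial_eval a x)"
  unfolding polynomial_function_def
proof (intro exI[of _ "Poly_Mapping.single a c"] conjI allI)
  show "mpoly_vars (Poly_Mapping.single a c) \<subseteq> V"
    using assms(1) by (auto simp: mpoly_vars_def split: if_splits)
  show "mpoly_degree_le (Poly_Mapping.single a c) D"
    using assms(2) by (auto simp: mpoly_degree_le_def monomial_degree_def split: if_splits)
  show "c * monomial_eval a x = mpoly_eval (Poly_Mapping.single a c) x" for x
    by (subst mpoly_eval_superset[of "{a}"]) auto
qed

lemma polynomial_function_const: "polynomial_function V D (\<lambda>x. c)"
  using polynomial_function_monomial[of 0 V D c] by (simp add: monomial_degree_def monomial_eval_def)

lemma polynomial_function_var: "v \<in> V \<Longrightarrow> polynomial_function V 1 (\<lambda>x. x v)"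
  using polynomial_function_monomial[of "Poly_Mapping.single v 1" V 1 1]
  by (simp add: monomial_degree_def monomial_eval_def)

lemma polynomial_function_add:
  assumes "polynomial_function V D g" "polynomial_function V D h"
  shows "polynomial_function V D (\<lambda>x. g x + h x)"
proof -
  obtain p q where p: "mpoly_vars p \<subseteq> V" "mpoly_degree_le p D" "\<And>x. g x = mpoly_eval p x"
    and q: "mpoly_vars q \<subseteq> V" "mpoly_degree_le q D" "\<And>x. h x = mpoly_eval q x"
    using assms unfolding polynomial_function_def by metis
  have "Poly_Mapping.keys (p + q) \<subseteq> Poly_Mapping.keys p \<union> Poly_Mapping.keys q"
    by (rule Poly_Mapping.keys_add)
  then have "mpoly_vars (p + q) \<subseteq> V" "mpoly_degree_le (p + q) D"
    using p(1,2) q(1,2) unfolding mpoly_vars_def mpoly_degree_le_def by blast+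
  then show ?thesis unfolding polynomial_function_def using p(3) q(3) mpoly_eval_add by metis
qed

lemma polynomial_function_sum:
  assumes "\<And>i. i \<in> I \<Longrightarrow> polynomial_function V D (g i)"
  shows "polynomial_function V D (\<lambda>x. \<Sum>i\<in>I. g i x)"
  using assms
  by (induction I rule: infinite_finite_induct)
    (auto intro!: polynomial_function_const polynomial_function_add)

text \<open>Expanding both factors into monomials gives a finite sum of multiples of
  \<open>monomial_eval (a + b)\<close>, and degrees of monomials add; closure under sums does the
  rest.\<close>

lemma polynomial_function_mult:
  assumes "polynomial_function V D g" "polynomial_function V E h"
  shows "polynomial_function V (D + E) (\<lambda>x. g x * h x)"
proof -
  obtain p q where p: "mpoly_vars p \<subseteq> V" "mpoly_degree_le p D" "\<And>x. g x = mpoly_eval p x"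
    and q: "mpoly_vars q \<subseteq> V" "mpoly_degree_le q E" "\<And>x. h x = mpoly_eval q x"
    using assms unfolding polynomial_function_def by metis
  have "(\<lambda>x. g x * h x) = (\<lambda>x. \<Sum>a\<in>Poly_Mapping.keys p. \<Sum>b\<in>Poly_Mapping.keys q.
      Poly_Mapping.lookup p a * Poly_Mapping.lookup q b * monomial_eval (a + b) x)"
    by (simp add: p(3) q(3) mpoly_eval_superset[OF finite_keys order_refl] sum_product
        monomial_eval_add mult_ac)
  moreover have "polynomial_function V (D + E) \<dots>"
  proof (intro polynomial_function_sum polynomial_function_monomial)
    fix a b assume a: "a \<in> Poly_Mapping.keys p" and b: "b \<in> Poly_Mapping.keys q"
    have "Poly_Mapping.keys (a + b) \<subseteq> Poly_Mapping.keys a \<union> Poly_Mapping.keys b"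
      by (rule Poly_Mapping.keys_add)
    then show "Poly_Mapping.keys (a + b) \<subseteq> V"
      using p(1) q(1) a b unfolding mpoly_vars_def by blast
    show "monomial_degree (a + b) \<le> D + E"
      using p(2) q(2) a b unfolding monomial_degree_add
      by (auto simp: mpoly_degree_le_def monomial_degree_def intro!: add_mono)
  qed
  ultimately show ?thesis by simp
qed

lemma polynomial_function_prod:
  assumes "finite I" "\<And>i. i \<in> I \<Longrightarrow> polynomial_function V D (g i)"
  shows "polynomial_function V (card I * D) (\<lambda>x. \<Prod>i\<in>I. g i x)"
  using assms
  by (induction I rule: finite_induct)
    (auto intro!: polynomial_function_const polynomial_function_mult)

subsection \<open>The random graph\<close>

lemma finite_vertex_pairs [simp]: "finite (vertex_pairs n)"
  by (rule finite_subset[of _ "Pow {1..n}"]) (auto simp: vertex_pairs_def)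

text \<open>Coordinates outside \<open>vertex_pairs n\<close> take the default value 0, so every
  \<open>e\<close> is covered and no membership condition has to be carried along.\<close>

lemma set_random_graph:
  assumes "Y \<in> set_pmf (random_graph n p)"
  shows "Y e \<in> {0, 1}"
proof -
  let ?b = "\<lambda>_::nat set. map_pmf of_bool (bernoulli_pmf p) :: real pmf"
  have "set_pmf (random_graph n p) \<subseteq> PiE_dflt (vertex_pairs n) 0 (set_pmf \<circ> ?b)"
    unfolding random_graph_def by (rule set_Pi_pmf_subset'[OF finite_vertex_pairs])
  then have Y: "Y \<in> PiE_dflt (vertex_pairs n) 0 (set_pmf \<circ> ?b)"
    using assms by (rule subsetD)
  have "set_pmf (?b e) \<subseteq> {0, 1}" by auto
  then show ?thesis
    using Y by (cases "e \<in> vertex_pairs n") (auto simp: PiE_dflt_def simp del: set_map_pmf)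
qed

lemma finite_set_Pi_pmf:
  assumes "finite A" "\<And>x. x \<in> A \<Longrightarrow> finite (set_pmf (p x))"
  shows "finite (set_pmf (Pi_pmf A dflt p))"
  unfolding set_Pi_pmf[OF assms(1)] by (rule finite_PiE_dflt) (simp_all add: assms)

lemma finite_set_random_graph [simp]: "finite (set_pmf (random_graph n p))"
  unfolding random_graph_def by (rule finite_set_Pi_pmf) simp_all

text \<open>The support is finite, so integrability never becomes a side condition.\<close>

lemma integrable_random_graph [simp]:
  fixes g :: "(nat set \<Rightarrow> real) \<Rightarrow> real"
  shows "integrable (measure_pmf (random_graph n p)) g"
  by (rule integrable_measure_pmf_finite) simp

abbreviation graph_expectation :: "nat \<Rightarrow> real \<Rightarrow> ((nat set \<Rightarrow> real) \<Rightarrow> real) \<Rightarrow> real" where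
  "graph_expectation n p \<equiv> measure_pmf.expectation (random_graph n p)"

abbreviation graph_prob :: "nat \<Rightarrow> real \<Rightarrow> (nat set \<Rightarrow> real) set \<Rightarrow> real" where
  "graph_prob n p \<equiv> measure_pmf.prob (random_graph n p)"

lemma graph_expectation_mono:
  assumes "\<And>Y. Y \<in> set_pmf (random_graph n p) \<Longrightarrow> g Y \<le> h Y"
  shows "graph_expectation n p g \<le> graph_expectation n p h"
  by (intro integral_mono_AE) (auto simp: AE_measure_pmf_iff assms)

lemma graph_expectation_cong:
  assumes "\<And>Y. Y \<in> set_pmf (random_graph n p) \<Longrightarrow> g Y = h Y"
  shows "graph_expectation n p g = graph_expectation n p h"
  by (intro integral_cong_AE) (auto simp: AE_measure_pmf_iff assms)

lemma graph_expectation_sum: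
  "graph_expectation n p (\<lambda>Y. \<Sum>i\<in>I. g i Y) = (\<Sum>i\<in>I. graph_expectation n p (g i))"
  by (rule Bochner_Integration.integral_sum) simp

text \<open>On the support \<open>g\<close> dominates the indicator of \<open>S\<close>. This form
  of Markov's inequality serves both the Chernoff bound and the domination estimate.\<close>

lemma graph_prob_le_expectation:
  assumes "\<And>Y. Y \<in> set_pmf (random_graph n p) \<Longrightarrow> 0 \<le> g Y"
    and "\<And>Y. Y \<in> set_pmf (random_graph n p) \<Longrightarrow> Y \<in> S \<Longrightarrow> 1 \<le> g Y"
  shows "graph_prob n p S \<le> graph_expectation n p g"
proof -
  have "graph_prob n p S = graph_expectation n p (indicator S)" by simp
  also have "\<dots> \<le> graph_expectation n p g"
    by (intro graph_expectation_mono) (auto simp: indicator_def assms)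
  finally show ?thesis .
qed

lemma graph_prob_mono:
  assumes "\<And>Y. Y \<in> set_pmf (random_graph n p) \<Longrightarrow> Y \<in> S \<Longrightarrow> Y \<in> T"
  shows "graph_prob n p S \<le> graph_prob n p T"
  by (rule measure_pmf.finite_measure_mono_AE) (auto simp: AE_measure_pmf_iff assms)

lemma graph_expectation_prod:
  assumes p: "0 \<le> p" "p \<le> 1" and F: "F \<subseteq> vertex_pairs n"
    and g: "\<And>v. 0 \<le> g v"
  shows "graph_expectation n p (\<lambda>Y. \<Prod>e\<in>F. g (Y e)) = (g 1 * p + g 0 * (1 - p)) ^ card F"
proof -
  \<comment> \<open>Padding with the factor 1 off \<open>F\<close> extends the product to all
    coordinates, as the product formula for \<open>Pi_pmf\<close> requires.\<close>
  let ?g = "\<lambda>e v. if e \<in> F then g v else 1"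
  have E: "(\<Prod>e\<in>F. G e) = (\<Prod>e\<in>vertex_pairs n. if e \<in> F then G e else 1)" for G :: "nat set \<Rightarrow> real"
    using F by (subst prod.inter_restrict[symmetric]) (auto simp: Int_absorb1)
  have "graph_expectation n p (\<lambda>Y. \<Prod>e\<in>F. g (Y e)) =
      graph_expectation n p (\<lambda>Y. \<Prod>e\<in>vertex_pairs n. ?g e (Y e))"
    by (subst E) (rule refl)
  also have "\<dots> = (\<Prod>e\<in>vertex_pairs n.
      measure_pmf.expectation (map_pmf of_bool (bernoulli_pmf p)) (\<lambda>v. ?g e v))"
    unfolding random_graph_def
    by (rule expectation_prod_Pi_pmf) (auto intro!: integrable_measure_pmf_finite g)
  also have "\<dots> = (\<Prod>e\<in>F. g 1 * p + g 0 * (1 - p))"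
    by (subst E) (auto intro!: prod.cong simp: p)
  finally show ?thesis by simp
qed

text \<open>The random graph is glued from two independent samples, one on \<open>F\<close> and one
  on the remaining pairs. That \<open>g\<close> and \<open>h\<close> each depend on one part only is
  expressed as invariance under changes elsewhere.\<close>

lemma graph_expectation_mult_indep:
  assumes F: "F \<subseteq> vertex_pairs n"
    and g: "\<And>Y Y'. (\<And>e. e \<in> F \<Longrightarrow> Y e = Y' e) \<Longrightarrow> g Y = g Y'"
    and h: "\<And>Y Y'. (\<And>e. e \<in> vertex_pairs n - F \<Longrightarrow> Y e = Y' e) \<Longrightarrow> h Y = h Y'"
  shows "graph_expectation n p (\<lambda>Y. g Y * h Y) = graph_expectation n p g * graph_expectation n p h"
proof -
  let ?b = "\<lambda>_::nat set. map_pmf of_bool (bernoulli_pmf p) :: real pmf"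
  let ?G = "vertex_pairs n - F"
  define P where "P = Pi_pmf F 0 ?b"
  define Q where "Q = Pi_pmf ?G 0 ?b"
  have fin: "finite F" using F finite_vertex_pairs by (rule finite_subset)
  have fP: "finite (set_pmf P)" unfolding P_def using fin by (intro finite_set_Pi_pmf) auto
  have fQ: "finite (set_pmf Q)" unfolding Q_def by (intro finite_set_Pi_pmf) auto
  have "F \<union> ?G = vertex_pairs n" using F by auto
  then have eq: "random_graph n p =
      map_pmf (\<lambda>(u, v) x. if x \<in> F then u x else v x) (pair_pmf P Q)"
    using Pi_pmf_union[of F ?G 0 ?b] fin unfolding random_graph_def P_def Q_def by auto
  have g': "g (\<lambda>x. if x \<in> F then u x else v x) = g u" for u v by (rule g) auto
  have h': "h (\<lambda>x. if x \<in> F then u x else v x) = h v" for u v by (rule h) auto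
  have "graph_expectation n p (\<lambda>Y. g Y * h Y) =
      measure_pmf.expectation (pair_pmf P Q) (\<lambda>z. g (fst z) * h (snd z))"
    by (simp add: eq case_prod_unfold g' h')
  also have "\<dots> = (\<Sum>z\<in>set_pmf P \<times> set_pmf Q. g (fst z) * h (snd z) * pmf (pair_pmf P Q) z)"
    using fP fQ by (subst integral_measure_pmf_real[of "set_pmf P \<times> set_pmf Q"]) auto
  also have "\<dots> = (\<Sum>u\<in>set_pmf P. \<Sum>v\<in>set_pmf Q. (g u * pmf P u) * (h v * pmf Q v))"
    by (subst sum.cartesian_product) (auto intro!: sum.cong simp: pmf_pair)
  also have "\<dots> = (\<Sum>u\<in>set_pmf P. g u * pmf P u) * (\<Sum>v\<in>set_pmf Q. h v * pmf Q v)"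
    by (simp add: sum_product)
  also have "\<dots> = measure_pmf.expectation P g * measure_pmf.expectation Q h"
    using fP fQ by (subst (1 2) integral_measure_pmf_real) auto
  also have "measure_pmf.expectation P g = graph_expectation n p g"
    by (simp add: eq case_prod_unfold g' expectation_pair_pmf_fst)
  also have "measure_pmf.expectation Q h = graph_expectation n p h"
    by (simp add: eq case_prod_unfold h' expectation_pair_pmf_snd)
  finally show ?thesis .
qed

section \<open>Chernoff bounds for the number of edges in a set of pairs\<close>

lemma mgf_edges_le:
  assumes p: "0 \<le> p" "p \<le> 1" and F: "F \<subseteq> vertex_pairs n"
  shows "graph_expectation n p (\<lambda>Y. exp (t * (\<Sum>e\<in>F. Y e))) \<le> exp (real (card F) * p * (exp t - 1))"
proof -
  have fin: "finite F" using F finite_vertex_pairs by (rule finite_subset)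
  have "graph_expectation n p (\<lambda>Y. exp (t * (\<Sum>e\<in>F. Y e))) =
      graph_expectation n p (\<lambda>Y. \<Prod>e\<in>F. exp (t * Y e))"
    by (simp add: sum_distrib_left exp_sum fin)
  also have "\<dots> = (exp t * p + (1 - p)) ^ card F"
    by (subst graph_expectation_prod[OF p F, of "\<lambda>v. exp (t * v)"]) auto
  also have "\<dots> \<le> exp (p * (exp t - 1)) ^ card F"
  proof (rule power_mono)
    show "exp t * p + (1 - p) \<le> exp (p * (exp t - 1))"
      using exp_ge_add_one_self[of "p * (exp t - 1)"] by (simp add: algebra_simps)
    show "0 \<le> exp t * p + (1 - p)" using p by (intro add_nonneg_nonneg) auto
  qed
  also have "\<dots> = exp (real (card F) * p * (exp t - 1))"
    by (simp add: exp_of_nat_mult[symmetric] mult_ac)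
  finally show ?thesis .
qed

text \<open>Exponential Markov inequality. The parameter stays open: fixed sets of pairs are treated
  with \<open>t = 1\<close>, while the union bound over small vertex sets needs a tuned
  \<open>t\<close>.\<close>

lemma prob_many_edges:
  assumes p: "0 \<le> p" "p \<le> 1" and F: "F \<subseteq> vertex_pairs n" and t: "0 \<le> t"
  shows "graph_prob n p {Y. a \<le> (\<Sum>e\<in>F. Y e)} \<le> exp (real (card F) * p * (exp t - 1) - t * a)"
proof -
  have "graph_prob n p {Y. a \<le> (\<Sum>e\<in>F. Y e)} \<le>
      graph_expectation n p (\<lambda>Y. exp (t * (\<Sum>e\<in>F. Y e)) * exp (- t * a))"
    using t by (intro graph_prob_le_expectation)
      (auto simp: exp_add[symmetric] mult.commute[of a] intro: mult_left_mono)
  also have "\<dots> = graph_expectation n p (\<lambda>Y. exp (t * (\<Sum>e\<in>F. Y e))) * exp (- t * a)"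
    by simp
  also have "\<dots> \<le> exp (real (card F) * p * (exp t - 1)) * exp (- t * a)"
    by (intro mult_right_mono mgf_edges_le p F) auto
  finally show ?thesis by (simp add: exp_add[symmetric])
qed

subsection \<open>The block greedy polynomial\<close>

definition root_poly :: "nat \<Rightarrow> real \<Rightarrow> real" where
  "root_poly M x = (\<Prod>m=1..M. 1 - x / real m)"

lemma root_poly_of_nat:
  assumes "N \<le> M"
  shows "root_poly M (real N) = (if N = 0 then 1 else 0)"
proof (cases "N = 0")
  case False
  then have "N \<in> {1..M}" "1 - real N / real N = 0" using assms by auto
  then show ?thesis using False unfolding root_poly_def by (auto intro!: prod_zero)
qed (simp add: root_poly_def)

text \<open>Every root \<open>m\<close> is at least 1, so each factor has absolute value at most
  \<open>1 + \<bar>x\<bar>\<close>. The moment bounds need this where the argument is not an integer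
  in \<open>0..M\<close>.\<close>

lemma abs_root_poly_le: "\<bar>root_poly M x\<bar> \<le> (1 + \<bar>x\<bar>) ^ M"
proof -
  have "\<bar>1 - x / real m\<bar> \<le> 1 + \<bar>x\<bar>" if "m \<in> {1..M}" for m
  proof -
    have "\<bar>x\<bar> / real m \<le> \<bar>x\<bar> / 1" using that by (intro divide_left_mono) auto
    then show ?thesis using abs_triangle_ineq4[of 1 "x / real m"] by simp
  qed
  then have "(\<Prod>m=1..M. \<bar>1 - x / real m\<bar>) \<le> (\<Prod>m=1..M. 1 + \<bar>x\<bar>)"
    by (intro prod_mono) auto
  then show ?thesis by (simp add: root_poly_def abs_prod)
qed

lemma polynomial_function_root_poly:
  assumes "polynomial_function V D g"
  shows "polynomial_function V (M * D) (\<lambda>x. root_poly M (g x))"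
proof -
  have "polynomial_function V D (\<lambda>x. 1 + (- 1 / real m) * g x)" for m
    using polynomial_function_mult[OF polynomial_function_const assms, of 0 "- 1 / real m"]
    by (intro polynomial_function_add polynomial_function_const) simp
  then have "polynomial_function V D (\<lambda>x. 1 - g x / real m)" for m
    by simp
  then show ?thesis
    using polynomial_function_prod[of "{1..M}" V D "\<lambda>m x. 1 - g x / real m"]
    unfolding root_poly_def by simp
qed

definition earlier :: "nat \<Rightarrow> nat \<Rightarrow> nat \<Rightarrow> nat set" where
  "earlier R n i = {j\<in>{1..n}. j mod R < i mod R}"

lemma finite_earlier [simp]: "finite (earlier R n i)"
  by (simp add: earlier_def)

function block_greedy :: "nat \<Rightarrow> nat \<Rightarrow> nat \<Rightarrow> (nat set \<Rightarrow> real) \<Rightarrow> nat \<Rightarrow> real" where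
  "block_greedy R M n Y i =
     root_poly M (\<Sum>j\<in>earlier R n i. Y {i, j} * block_greedy R M n Y j)"
  by pat_completeness auto
termination
  by (relation "Wellfounded.measure (\<lambda>(R, M, n, Y, i). i mod R)") (auto simp: earlier_def)

declare block_greedy.simps [simp del]

text \<open>Each round turns a degree bound \<open>D\<close> into \<open>M * (1 + D)\<close>. The
  bound depends on the number of rounds and on \<open>M\<close> only, hence \<open>D\<close> is
  chosen before \<open>n\<close>.\<close>

lemma block_greedy_polynomial:
  "\<exists>D. \<forall>n. \<forall>i\<in>{1..n}. i mod R < t \<longrightarrow>
     polynomial_function (vertex_pairs n) D (\<lambda>Y. block_greedy R M n Y i)"
proof (induction t)
  case 0
  show ?case by simp
next
  case (Suc t)
  then obtain D where D: "\<And>n i. i \<in> {1..n} \<Longrightarrow> i mod R < t \<Longrightarrow>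
      polynomial_function (vertex_pairs n) D (\<lambda>Y. block_greedy R M n Y i)" by blast
  have "polynomial_function (vertex_pairs n) (M * (1 + D)) (\<lambda>Y. block_greedy R M n Y i)"
    if i: "i \<in> {1..n}" "i mod R < Suc t" for n i
  proof (subst block_greedy.simps, intro polynomial_function_root_poly polynomial_function_sum
      polynomial_function_mult polynomial_function_var)
    fix j assume j: "j \<in> earlier R n i"
    then have "i \<noteq> j" "j \<in> {1..n}" by (auto simp: earlier_def)
    then show "{i, j} \<in> vertex_pairs n" using i by (auto simp: vertex_pairs_def card_2_iff)
    show "polynomial_function (vertex_pairs n) D (\<lambda>Y. block_greedy R M n Y j)"
      using j i by (intro D) (auto simp: earlier_def)
  qed
  then show ?case by blast
qed

text \<open>The recursion descends only into earlier rounds, so no pair with an end in a later round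
  than \<open>i\<close> is ever read. This gives independence from the edges at a later
  vertex.\<close>

lemma block_greedy_cong:
  assumes "i \<in> {1..n}"
    and "\<And>e. e \<in> vertex_pairs n \<Longrightarrow> (\<And>a. a \<in> e \<Longrightarrow> a mod R \<le> i mod R) \<Longrightarrow> Y e = Y' e"
  shows "block_greedy R M n Y i = block_greedy R M n Y' i"
  using assms
proof (induction "i mod R" arbitrary: i rule: less_induct)
  case less
  have "Y {i, j} * block_greedy R M n Y j = Y' {i, j} * block_greedy R M n Y' j"
    if j: "j \<in> earlier R n i" for j
  proof -
    have "i \<noteq> j" "j \<in> {1..n}" using j by (auto simp: earlier_def)
    then have "{i, j} \<in> vertex_pairs n"
      using less.prems(1) by (auto simp: vertex_pairs_def card_2_iff)
    moreover have "a mod R \<le> i mod R" if "a \<in> {i, j}" for a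
      using that j by (auto simp: earlier_def)
    ultimately have "Y {i, j} = Y' {i, j}" by (rule less.prems(2))
    moreover have "block_greedy R M n Y j = block_greedy R M n Y' j"
    proof (rule less.hyps)
      show "j mod R < i mod R" "j \<in> {1..n}" using j by (auto simp: earlier_def)
      then show "Y e = Y' e"
        if "e \<in> vertex_pairs n" "\<And>a. a \<in> e \<Longrightarrow> a mod R \<le> j mod R" for e
        using that by (intro less.prems(2)) (auto intro: le_trans less_imp_le)
    qed
    ultimately show ?thesis by simp
  qed
  then show ?case by (subst (1 2) block_greedy.simps) (simp cong: sum.cong)
qed

section \<open>Values away from vertices of high degree\<close>

definition neighbours :: "nat \<Rightarrow> (nat set \<Rightarrow> real) \<Rightarrow> nat set \<Rightarrow> nat set" where
  "neighbours n Y Z = {i\<in>{1..n}. \<exists>j\<in>Z. adjacent Y i j}"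

lemma adjacent_sym: "adjacent Y i j \<longleftrightarrow> adjacent Y j i"
  by (auto simp: adjacent_def insert_commute)

primrec heavy_ball :: "nat \<Rightarrow> nat \<Rightarrow> (nat set \<Rightarrow> real) \<Rightarrow> nat \<Rightarrow> nat set" where
  "heavy_ball M n Y 0 = {i\<in>{1..n}. M < card (neighbours n Y {i})}"
| "heavy_ball M n Y (Suc t) = heavy_ball M n Y t \<union> neighbours n Y (heavy_ball M n Y t)"

lemma heavy_ball_subset: "heavy_ball M n Y t \<subseteq> {1..n}"
  by (induction t) (auto simp: neighbours_def)

lemma finite_heavy_ball [simp]: "finite (heavy_ball M n Y t)"
  by (rule finite_subset[OF heavy_ball_subset]) simp

lemma heavy_ball_0_subset: "heavy_ball M n Y 0 \<subseteq> heavy_ball M n Y t"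
  by (induction t) auto

text \<open>Induction on the radius. Neighbours of a vertex outside the ball of radius
  \<open>t + 1\<close> lie outside the ball of radius \<open>t\<close>, so the earlier ones have
  values 0 or 1 and the sum counts the selected ones. As \<open>i\<close> has at most
  \<open>M\<close> neighbours, the count is in the range where \<open>root_poly\<close> tests for
  zero.\<close>

lemma block_greedy_off_heavy_ball:
  assumes Y: "\<And>e. Y e \<in> {0, 1}"
  shows "i \<in> {1..n} \<Longrightarrow> i \<notin> heavy_ball M n Y t \<Longrightarrow> i mod R \<le> t \<Longrightarrow>
    block_greedy R M n Y i =
      (if \<exists>j\<in>earlier R n i. adjacent Y i j \<and> block_greedy R M n Y j = 1 then 0 else 1)"
proof (induction t arbitrary: i)
  case 0
  then have "earlier R n i = {}" by (auto simp: earlier_def)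
  then show ?case by (subst block_greedy.simps) (simp add: root_poly_def)
next
  case (Suc t)
  let ?g = "block_greedy R M n Y"
  let ?S = "{j\<in>earlier R n i. adjacent Y i j \<and> ?g j = 1}"
  have "Y {i, j} * ?g j = (if adjacent Y i j \<and> ?g j = 1 then 1 else 0)"
    if j: "j \<in> earlier R n i" for j
  proof (cases "adjacent Y i j")
    case True
    have "j \<notin> heavy_ball M n Y t"
      using Suc.prems(1,2) True by (auto simp: neighbours_def)
    then have "?g j \<in> {0, 1}"
      using Suc.IH[of j] j Suc.prems(3) by (auto simp: earlier_def)
    then show ?thesis using True by (auto simp: adjacent_def)
  next
    case False
    then have "Y {i, j} \<noteq> 1" using j by (auto simp: adjacent_def earlier_def)
    then show ?thesis using Y[of "{i, j}"] False by auto
  qed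
  then have "(\<Sum>j\<in>earlier R n i. Y {i, j} * ?g j) =
      (\<Sum>j\<in>earlier R n i. if adjacent Y i j \<and> ?g j = 1 then 1 else 0)"
    by (intro sum.cong) auto
  also have "\<dots> = real (card ?S)" by (simp add: sum.If_cases Int_def)
  finally have sum: "(\<Sum>j\<in>earlier R n i. Y {i, j} * ?g j) = real (card ?S)" .
  have "?S \<subseteq> neighbours n Y {i}"
    by (auto simp: neighbours_def earlier_def adjacent_sym)
  then have "card ?S \<le> card (neighbours n Y {i})"
    by (intro card_mono) (auto simp: neighbours_def)
  also have "\<dots> \<le> M"
    using Suc.prems(1,2) heavy_ball_0_subset[of M n Y "Suc t"] by (auto simp: not_less)
  finally have "?g i = (if card ?S = 0 then 1 else 0)"
    by (subst block_greedy.simps) (simp only: sum root_poly_of_nat)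
  then show ?case by (auto simp: card_eq_0_iff)
qed

section \<open>From dominating sets to the size of the rounded set\<close>

definition dominating :: "nat \<Rightarrow> (nat set \<Rightarrow> real) \<Rightarrow> nat set \<Rightarrow> bool" where
  "dominating n Y U \<longleftrightarrow> U \<subseteq> {1..n} \<and> (\<forall>i\<in>{1..n} - U. \<exists>j\<in>U. adjacent Y i j)"

definition block_pairs :: "nat \<Rightarrow> nat \<Rightarrow> nat set set" where
  "block_pairs R n = {e\<in>vertex_pairs n. \<forall>a\<in>e. \<forall>b\<in>e. a mod R = b mod R}"

lemma sum_edges_eq_card:
  fixes Y :: "nat set \<Rightarrow> real"
  assumes "finite F" "\<And>e. Y e \<in> {0, 1}"
  shows "(\<Sum>e\<in>F. Y e) = real (card {e\<in>F. Y e = 1})"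
proof -
  have "Y e = (if Y e = 1 then 1 else 0)" for e using assms(2)[of e] by auto
  then have "(\<Sum>e\<in>F. Y e) = (\<Sum>e\<in>F. if Y e = 1 then 1 else 0)" by (intro sum.cong) auto
  then show ?thesis using assms(1) by (simp add: sum.If_cases Int_def)
qed

text \<open>The vertices with value at least \<open>1\<close> and the heavy ball together dominate the graph.\<close>

lemma card_rounded_set_block_greedy:
  assumes Y: "\<And>e. Y e \<in> {0, 1}" and R: "0 < R"
    and dom: "\<And>U. dominating n Y U \<Longrightarrow> s \<le> real (card U)"
    and small: "2 * real (card (heavy_ball M n Y (Suc R))) + 2 * (\<Sum>e\<in>block_pairs R n. Y e) \<le> b"
    and b: "b \<le> \<eta> * real n"
  shows "s - b \<le> real (card (rounded_set n \<eta> (block_greedy R M n) Y))"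
proof -
  let ?g = "block_greedy R M n Y"
  let ?W = "heavy_ball M n Y R"
  let ?Z = "heavy_ball M n Y (Suc R)"
  let ?E = "{e\<in>block_pairs R n. Y e = 1}"
  define A where "A = {i\<in>{1..n}. ?g i \<ge> 1}"
  define A' where "A' = {i\<in>A. \<not> (\<exists>j\<in>A. adjacent Y i j)}"
  define B where "B = {i\<in>{1..n}. ?g i \<in> {1/2<..<1}}"
  have finA: "finite A" unfolding A_def by simp
  have val: "?g i = (if \<exists>j\<in>earlier R n i. adjacent Y i j \<and> ?g j = 1 then 0 else 1)"
    if "i \<in> {1..n}" "i \<notin> ?W" for i
    using that R by (intro block_greedy_off_heavy_ball[OF Y, where t = R]) (auto simp: less_imp_le)
  have finE: "finite ?E" by (simp add: block_pairs_def)
  \<comment> \<open>Off the ball all values are 0 or 1, so none lies strictly between 1/2 and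
    1.\<close>
  have B: "B \<subseteq> ?Z"
  proof
    fix i assume "i \<in> B"
    then have "i \<in> {1..n}" "?g i \<noteq> 0" "?g i \<noteq> 1" by (auto simp: B_def)
    then show "i \<in> ?Z" using val[of i] by (cases "i \<in> ?W") (auto split: if_splits)
  qed
  have AA': "A - A' \<subseteq> ?Z \<union> \<Union>?E"
  proof
    fix i assume "i \<in> A - A'"
    then obtain j where i: "i \<in> A" and j: "j \<in> A" and adj: "adjacent Y i j"
      by (auto simp: A'_def)
    show "i \<in> ?Z \<union> \<Union>?E"
    \<comment> \<open>The radius \<open>Suc R\<close> absorbs the case that only the neighbour
      \<open>j\<close> lies in the ball of radius \<open>R\<close>. If neither end does, both are
      selected, so neither is in an earlier round than the other and the edge is inside a
      block.\<close>
    proof (cases "i \<in> ?W \<or> j \<in> ?W")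
      case True
      then show ?thesis using i adj by (auto simp: neighbours_def A_def)
    next
      case False
      then have vi: "?g i = 1" "\<not> (\<exists>k\<in>earlier R n i. adjacent Y i k \<and> ?g k = 1)"
        and vj: "?g j = 1" "\<not> (\<exists>k\<in>earlier R n j. adjacent Y j k \<and> ?g k = 1)"
        using i j val[of i] val[of j] by (auto simp: A_def split: if_splits)
      have "i mod R = j mod R"
        using vi vj adj i j adjacent_sym[of Y i j]
        by (cases "i mod R" "j mod R" rule: linorder_cases) (auto simp: earlier_def A_def)
      then have "{i, j} \<in> ?E"
        using i j adj by (auto simp: block_pairs_def vertex_pairs_def A_def adjacent_def)
      then show ?thesis by blast
    qed
  qed
  have card_AA': "real (card (A - A')) \<le> real (card ?Z) + 2 * (\<Sum>e\<in>block_pairs R n. Y e)"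
  proof -
    have e2: "card e = 2" if "e \<in> ?E" for e
      using that by (auto simp: block_pairs_def vertex_pairs_def)
    have "card (A - A') \<le> card (?Z \<union> \<Union>?E)"
      using finE e2 by (intro card_mono AA' finite_UnI finite_heavy_ball finite_Union) (auto intro: card_ge_0_finite)
    also have "\<dots> \<le> card ?Z + card (\<Union>?E)" by (rule card_Un_le)
    also have "card (\<Union>?E) \<le> (\<Sum>e\<in>?E. card e)" by (rule card_Union_le_sum_card)
    also have "\<dots> = 2 * card ?E" using e2 by simp
    finally show ?thesis using sum_edges_eq_card[OF _ Y, of "block_pairs R n"]
      by (simp add: block_pairs_def)
  qed
  have "real (card B) \<le> real (card ?Z)"
    using card_mono[OF finite_heavy_ball B] by simp
  \<comment> \<open>The factor 2 on the heavy ball pays once for \<open>A - A'\<close> and once for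
    \<open>B\<close>.\<close>
  then have cond: "real (card (A - A') + card B) \<le> b"
    using card_AA' small by simp
  then have "rounded_set n \<eta> (block_greedy R M n) Y = A'"
    using b unfolding rounded_set_def A_def A'_def B_def Let_def by simp
  moreover have "dominating n Y (A \<union> ?Z)"
    unfolding dominating_def
  proof (intro conjI ballI)
    show "A \<union> ?Z \<subseteq> {1..n}" using heavy_ball_subset[of M n Y "Suc R"] by (auto simp: A_def)
    fix i assume i: "i \<in> {1..n} - (A \<union> ?Z)"
    then have "?g i \<noteq> 1" by (auto simp: A_def)
    then obtain j where "j \<in> earlier R n i" "adjacent Y i j" "?g j = 1"
      using i val[of i] by (auto split: if_splits)
    then show "\<exists>j\<in>A \<union> ?Z. adjacent Y i j" by (auto simp: A_def earlier_def)
  qed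
  then have "s \<le> real (card (A \<union> ?Z))" by (rule dom)
  moreover have "card (A \<union> ?Z) \<le> card A' + card (A - A') + card ?Z"
  proof -
    have eq: "A \<union> ?Z = A' \<union> (A - A') \<union> ?Z" by (auto simp: A'_def)
    show ?thesis
      unfolding eq using card_Un_le[of "A' \<union> (A - A')" ?Z] card_Un_le[of A' "A - A'"] by linarith
  qed
  \<comment> \<open>The same budget again: the sizes of \<open>A - A'\<close> and of the heavy ball
    add up to at most \<open>b\<close>, which leaves at least \<open>s - b\<close> vertices for
    \<open>A'\<close>.\<close>
  ultimately show ?thesis using card_AA' small by simp
qed

subsection \<open>Events of probability exponentially close to one\<close>

text \<open>The rate is existential and the bound only eventual, so that finitely many estimates
  combine without tracking constants.\<close>

definition exp_small :: "(nat \<Rightarrow> real) \<Rightarrow> bool" where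
  "exp_small a \<longleftrightarrow> (\<exists>c>0. \<forall>\<^sub>F n in sequentially. a n \<le> exp (- c * real n))"

lemma exp_small_mono:
  assumes "exp_small b" "\<forall>\<^sub>F n in sequentially. a n \<le> b n"
  shows "exp_small a"
proof -
  obtain c where c: "c > 0" "\<forall>\<^sub>F n in sequentially. b n \<le> exp (- c * real n)"
    using assms(1) unfolding exp_small_def by blast
  from c(2) assms(2) have "\<forall>\<^sub>F n in sequentially. a n \<le> exp (- c * real n)"
    by eventually_elim (rule order_trans)
  then show ?thesis unfolding exp_small_def using c(1) by blast
qed

lemma exp_small_add:
  assumes "exp_small a" "exp_small b"
  shows "exp_small (\<lambda>n. a n + b n)"
proof -
  obtain c where c: "c > 0" "\<forall>\<^sub>F n in sequentially. a n \<le> exp (- c * real n)"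
    using assms(1) unfolding exp_small_def by blast
  obtain c' where c': "c' > 0" "\<forall>\<^sub>F n in sequentially. b n \<le> exp (- c' * real n)"
    using assms(2) unfolding exp_small_def by blast
  \<comment> \<open>Half of the smaller rate: the other half absorbs the factor 2 from adding the
    bounds, once \<open>n\<close> is at least \<open>ln 2 / m\<close>.\<close>
  define m where "m = min c c' / 2"
  have m: "m > 0" "2 * m \<le> c" "2 * m \<le> c'" using c(1) c'(1) by (auto simp: m_def)
  have "\<forall>\<^sub>F n in sequentially. ln 2 / m \<le> real n" by real_asymp
  with c(2) c'(2) have "\<forall>\<^sub>F n in sequentially. a n + b n \<le> exp (- m * real n)"
  proof eventually_elim
    case (elim n)
    have "ln 2 \<le> m * real n" using elim(3) m(1) by (simp add: field_simps)
    then have 2: "2 \<le> exp (m * real n)" by (metis exp_le_cancel_iff exp_ln zero_less_numeral)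
    have "exp (- c * real n) \<le> exp (- (2 * m) * real n)" "exp (- c' * real n) \<le> exp (- (2 * m) * real n)"
      using m by (auto intro!: mult_right_mono)
    then have "a n + b n \<le> 2 * exp (- (2 * m) * real n)" using elim(1,2) by linarith
    also have "\<dots> \<le> exp (m * real n) * exp (- (2 * m) * real n)"
      using 2 by (intro mult_right_mono) auto
    also have "\<dots> = exp (- m * real n)" by (simp add: exp_add[symmetric])
    finally show ?case .
  qed
  then show ?thesis unfolding exp_small_def using m(1) by blast
qed

definition overwhelming :: "real \<Rightarrow> (nat \<Rightarrow> (nat set \<Rightarrow> real) \<Rightarrow> bool) \<Rightarrow> bool" where
  "overwhelming d P \<longleftrightarrow> exp_small (\<lambda>n. graph_prob n (d / real n) {Y. \<not> P n Y})"

text \<open>All mass sits on 0/1 vectors, so the deterministic part of an argument may assume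
  them.\<close>

lemma overwhelming_mono:
  assumes "overwhelming d P"
    and "\<forall>\<^sub>F n in sequentially. \<forall>Y. (\<forall>e. Y e \<in> {0, 1}) \<longrightarrow> P n Y \<longrightarrow> Q n Y"
  shows "overwhelming d Q"
  unfolding overwhelming_def
proof (rule exp_small_mono)
  show "exp_small (\<lambda>n. graph_prob n (d / real n) {Y. \<not> P n Y})"
    using assms(1) unfolding overwhelming_def .
  show "\<forall>\<^sub>F n in sequentially.
      graph_prob n (d / real n) {Y. \<not> Q n Y} \<le> graph_prob n (d / real n) {Y. \<not> P n Y}"
    using assms(2)
  proof eventually_elim
    case (elim n)
    then show ?case using set_random_graph by (intro graph_prob_mono) blast
  qed
qed

lemma overwhelming_conj:
  assumes "overwhelming d P" "overwhelming d Q"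
  shows "overwhelming d (\<lambda>n Y. P n Y \<and> Q n Y)"
  unfolding overwhelming_def
proof (rule exp_small_mono)
  let ?\<mu> = "\<lambda>n. graph_prob n (d / real n)"
  show "exp_small (\<lambda>n. ?\<mu> n {Y. \<not> P n Y} + ?\<mu> n {Y. \<not> Q n Y})"
    using assms unfolding overwhelming_def by (rule exp_small_add)
  have "{Y. \<not> (P n Y \<and> Q n Y)} = {Y. \<not> P n Y} \<union> {Y. \<not> Q n Y}" for n by auto
  then show "\<forall>\<^sub>F n in sequentially.
      ?\<mu> n {Y. \<not> (P n Y \<and> Q n Y)} \<le> ?\<mu> n {Y. \<not> P n Y} + ?\<mu> n {Y. \<not> Q n Y}"
    by (simp add: measure_Un_le)
qed

lemma overwhelmingI:
  assumes "c > 0"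
    and "\<forall>\<^sub>F n in sequentially. graph_prob n (d / real n) {Y. \<not> P n Y} \<le> exp (- c * real n)"
  shows "overwhelming d P"
  using assms unfolding overwhelming_def exp_small_def by blast

lemma eventually_edge_prob:
  assumes "d > 0" "\<delta> > 0"
  shows "\<forall>\<^sub>F n in sequentially. n > 0 \<and> 0 \<le> d / real n \<and> d / real n \<le> \<delta>"
proof -
  have "\<forall>\<^sub>F n in sequentially. real n \<ge> max 1 (d / \<delta>)" by real_asymp
  then show ?thesis
  proof eventually_elim
    case (elim n)
    then have "n > 0" "d / \<delta> \<le> real n" by auto
    then show ?case using assms by (auto simp: field_simps)
  qed
qed

subsection \<open>Neighbourhoods of small vertex sets\<close>

definition touching :: "nat \<Rightarrow> nat set \<Rightarrow> nat set set" where
  "touching n Z = {e\<in>vertex_pairs n. e \<inter> Z \<noteq> {}}"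

lemma card_touching_le:
  assumes "Z \<subseteq> {1..n}"
  shows "card (touching n Z) \<le> card Z * n"
proof -
  have fin: "finite Z" using assms by (rule finite_subset) simp
  have "touching n Z \<subseteq> (\<lambda>(a, b). {a, b}) ` (Z \<times> {1..n})"
    by (fastforce simp: touching_def vertex_pairs_def card_2_iff)
  then have "card (touching n Z) \<le> card (Z \<times> {1..n})"
    using fin by (intro surj_card_le) auto
  then show ?thesis by (simp add: card_cartesian_product)
qed

text \<open>Each \<open>i\<close> in the set picks a neighbour \<open>w i\<close> in
  \<open>Z\<close>. The edge \<open>{i, w i}\<close> has exactly one end outside \<open>Z\<close>,
  so it determines \<open>i\<close>.\<close>

lemma card_neighbours_diff_le:
  assumes "\<And>e. Y e \<in> {0, 1}" "Z \<subseteq> {1..n}"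
  shows "real (card (neighbours n Y Z - Z)) \<le> (\<Sum>e\<in>touching n Z. Y e)"
proof -
  have "\<forall>i\<in>neighbours n Y Z - Z. \<exists>j\<in>Z. adjacent Y i j" by (auto simp: neighbours_def)
  then obtain w where w: "\<And>i. i \<in> neighbours n Y Z - Z \<Longrightarrow> w i \<in> Z \<and> adjacent Y i (w i)"
    by metis
  let ?E = "{e\<in>touching n Z. Y e = 1}"
  have fin: "finite (touching n Z)" by (simp add: touching_def)
  have "inj_on (\<lambda>i. {i, w i}) (neighbours n Y Z - Z)"
    using w by (auto intro!: inj_onI simp: doubleton_eq_iff)
  moreover have "(\<lambda>i. {i, w i}) ` (neighbours n Y Z - Z) \<subseteq> ?E"
  proof
    fix e assume "e \<in> (\<lambda>i. {i, w i}) ` (neighbours n Y Z - Z)"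
    then obtain i where i: "i \<in> neighbours n Y Z - Z" "e = {i, w i}" by auto
    then have wi: "w i \<in> Z" "i \<noteq> w i" "Y {i, w i} = 1"
      using w[OF i(1)] by (simp_all add: adjacent_def)
    moreover have "i \<in> {1..n}" using i(1) by (simp add: neighbours_def)
    moreover have "w i \<in> {1..n}" using wi(1) assms(2) by blast
    ultimately show "e \<in> ?E" by (simp add: i(2) touching_def vertex_pairs_def)
  qed
  ultimately have "card (neighbours n Y Z - Z) \<le> card ?E"
    using fin by (intro card_inj_on_le) auto
  then show ?thesis using sum_edges_eq_card[OF fin assms(1)] by simp
qed

text \<open>The degrees add up to twice the number of edges, hence with overwhelming probability to
  less than \<open>4 * d * n\<close>. So at most a fraction \<open>4 * d / M\<close> of the vertices
  have degree above \<open>M\<close>.\<close>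

lemma overwhelming_few_heavy:
  assumes d: "d > 0" and \<beta>: "\<beta> > 0"
  shows "\<exists>M. overwhelming d (\<lambda>n Y. real (card (heavy_ball M n Y 0)) \<le> \<beta> * real n)"
proof -
  obtain M :: nat where M: "4 * d / \<beta> \<le> real M" using real_arch_simple by blast
  \<comment> \<open>Chernoff bound with \<open>t = 1\<close>: the mean is at most
    \<open>d * n / 2\<close> and \<open>exp 1 - 1\<close> at most 2, so the exponent is at most
    \<open>d * n - 2 * d * n\<close>.\<close>
  have many: "overwhelming d (\<lambda>n Y. (\<Sum>e\<in>vertex_pairs n. Y e) < 2 * d * real n)"
  proof (rule overwhelmingI[OF d])
    show "\<forall>\<^sub>F n in sequentially.
        graph_prob n (d / real n) {Y. \<not> (\<Sum>e\<in>vertex_pairs n. Y e) < 2 * d * real n} \<le> exp (- d * real n)"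
      using eventually_edge_prob[OF d zero_less_one]
    proof eventually_elim
      case (elim n)
      have "2 * (n choose 2) \<le> n * (n - 1)" by (simp add: choose_two)
      also have "\<dots> \<le> n * n" by simp
      finally have "real (2 * (n choose 2)) \<le> real (n * n)" by (rule of_nat_mono)
      then have "real (card (vertex_pairs n)) \<le> real n * real n / 2"
        by (simp add: card_vertex_pairs)
      then have "real (card (vertex_pairs n)) * (d / real n) \<le> real n * real n / 2 * (d / real n)"
        using elim by (intro mult_right_mono) auto
      also have "\<dots> = real n * d / 2" using elim by (simp add: field_simps)
      finally have "real (card (vertex_pairs n)) * (d / real n) * (exp 1 - 1) \<le> real n * d / 2 * 2"
        using exp_le d by (intro mult_mono[of _ "real n * d / 2" "exp 1 - 1"]) auto
      then have "real (card (vertex_pairs n)) * (d / real n) * (exp 1 - 1) - 1 * (2 * d * real n) \<le> - d * real n"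
        by (simp add: mult.commute[of "real n" d])
      then have "exp (real (card (vertex_pairs n)) * (d / real n) * (exp 1 - 1) - 1 * (2 * d * real n)) \<le> exp (- d * real n)"
        by (rule exp_le_cancel_iff[THEN iffD2])
      moreover have "graph_prob n (d / real n) {Y. 2 * d * real n \<le> (\<Sum>e\<in>vertex_pairs n. Y e)} \<le>
          exp (real (card (vertex_pairs n)) * (d / real n) * (exp 1 - 1) - 1 * (2 * d * real n))"
        by (rule prob_many_edges) (use elim in auto)
      ultimately show ?case unfolding not_less by (rule order_trans[rotated])
    qed
  qed
  have "overwhelming d (\<lambda>n Y. real (card (heavy_ball M n Y 0)) \<le> \<beta> * real n)"
  proof (rule overwhelming_mono[OF many], intro always_eventually allI impI)
    fix n and Y :: "nat set \<Rightarrow> real"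
    assume Y: "\<forall>e. Y e \<in> {0, 1}" and few: "(\<Sum>e\<in>vertex_pairs n. Y e) < 2 * d * real n"
    let ?H = "heavy_ball M n Y 0"
    have deg: "real (card (neighbours n Y {i})) \<le> (\<Sum>e\<in>{e\<in>vertex_pairs n. i \<in> e}. Y e)" if "i \<in> {1..n}" for i
    proof -
      have "neighbours n Y {i} - {i} = neighbours n Y {i}" by (auto simp: neighbours_def adjacent_def)
      moreover have "touching n {i} = {e\<in>vertex_pairs n. i \<in> e}" by (auto simp: touching_def)
      ultimately show ?thesis using card_neighbours_diff_le[of Y "{i}" n] Y that by auto
    qed
    have "real M * real (card ?H) = (\<Sum>i\<in>?H. real M)" by simp
    also have "\<dots> \<le> (\<Sum>i\<in>?H. real (card (neighbours n Y {i})))" by (intro sum_mono) auto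
    also have "\<dots> \<le> (\<Sum>i\<in>{1..n}. real (card (neighbours n Y {i})))"
      by (intro sum_mono2) auto
    also have "\<dots> \<le> (\<Sum>i\<in>{1..n}. \<Sum>e\<in>{e\<in>vertex_pairs n. i \<in> e}. Y e)" by (intro sum_mono deg)
    also have "\<dots> = (\<Sum>e\<in>vertex_pairs n. \<Sum>i\<in>{i\<in>{1..n}. i \<in> e}. Y e)"
      by (rule sum.swap_restrict) auto
    also have "\<dots> = (\<Sum>e\<in>vertex_pairs n. 2 * Y e)"
    proof (rule sum.cong[OF refl])
      fix e assume e: "e \<in> vertex_pairs n"
      then have "{i\<in>{1..n}. i \<in> e} = e" by (auto simp: vertex_pairs_def)
      then show "(\<Sum>i\<in>{i\<in>{1..n}. i \<in> e}. Y e) = 2 * Y e" using e by (simp add: vertex_pairs_def)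
    qed
    also have "\<dots> = 2 * (\<Sum>e\<in>vertex_pairs n. Y e)" by (simp add: sum_distrib_left)
    finally have "real M * real (card ?H) \<le> 4 * d * real n" using few by simp
    moreover have "4 * d / \<beta> * real (card ?H) \<le> real M * real (card ?H)"
      using M by (intro mult_right_mono) auto
    ultimately have "4 * d / \<beta> * real (card ?H) \<le> 4 * d * real n" by linarith
    then show "real (card ?H) \<le> \<beta> * real n" using d \<beta> by (simp add: field_simps)
  qed
  then show ?thesis by blast
qed

text \<open>A small set is touched by few edges, and each new neighbour accounts for one of them. A
  union bound treats all small sets at once.\<close>

lemma overwhelming_expansion:
  assumes d: "d > 0" and \<beta>': "\<beta>' > 0"
  shows "\<exists>\<beta>>0. overwhelming d (\<lambda>n Y. \<forall>Z. Z \<subseteq> {1..n} \<longrightarrow> real (card Z) \<le> \<beta> * real n \<longrightarrow>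
    real (card (Z \<union> neighbours n Y Z)) \<le> \<beta>' * real n)"
proof -
  \<comment> \<open>\<open>t\<close> is chosen so that \<open>t\<close> times the allowed number
    \<open>\<beta>' / 2 * n\<close> of edges is \<open>3 * n\<close>, and \<open>\<beta>\<close> so
    that the moment term costs at most \<open>n\<close>. Each set then fails with probability at
    most \<open>exp (- 2 * n)\<close>, which beats the at most \<open>2 ^ n\<close>
    candidates.\<close>
  define t where "t = 6 / \<beta>'"
  define \<beta> where "\<beta> = min (\<beta>' / 2) (1 / (d * exp t))"
  have t: "t > 0" "t * (\<beta>' / 2) = 3" using \<beta>' by (auto simp: t_def)
  have \<beta>: "\<beta> > 0" "\<beta> \<le> \<beta>' / 2" "\<beta> * d * exp t \<le> 1"
    using d \<beta>' by (auto simp: \<beta>_def min_def field_simps)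
  let ?S = "\<lambda>n. {Z. Z \<subseteq> {1..n} \<and> real (card Z) \<le> \<beta> * real n}"
  let ?a = "\<lambda>n. \<beta>' / 2 * real n"
  have few: "overwhelming d (\<lambda>n Y. \<forall>Z\<in>?S n. (\<Sum>e\<in>touching n Z. Y e) < ?a n)"
  proof (rule overwhelmingI[OF zero_less_one])
    show "\<forall>\<^sub>F n in sequentially. graph_prob n (d / real n)
        {Y. \<not> (\<forall>Z\<in>?S n. (\<Sum>e\<in>touching n Z. Y e) < ?a n)} \<le> exp (- 1 * real n)"
      using eventually_edge_prob[OF d zero_less_one]
    proof eventually_elim
      case (elim n)
      have finS: "finite (?S n)" by (rule finite_subset[of _ "Pow {1..n}"]) auto
      have "card (?S n) \<le> card (Pow {1..n})" by (rule card_mono) auto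
      then have "card (?S n) \<le> 2 ^ n" by (simp add: card_Pow)
      then have "real (card (?S n)) \<le> 2 ^ n" by (metis of_nat_le_iff of_nat_numeral of_nat_power)
      also have "\<dots> \<le> exp 1 ^ n" using exp_ge_add_one_self[of 1] by (intro power_mono) auto
      finally have cardS: "real (card (?S n)) \<le> exp (real n)" by (simp add: exp_of_nat_mult[symmetric])
      have each: "graph_prob n (d / real n) {Y. ?a n \<le> (\<Sum>e\<in>touching n Z. Y e)} \<le> exp (- 2 * real n)"
        if Z: "Z \<in> ?S n" for Z
      proof -
        have "real (card (touching n Z)) \<le> real (card Z) * real n"
          using card_touching_le[of Z n] Z by (metis (mono_tags, lifting) mem_Collect_eq of_nat_mono of_nat_mult)
        also have "\<dots> \<le> \<beta> * real n * real n" using Z by (intro mult_right_mono) auto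
        finally have "real (card (touching n Z)) * (d / real n) \<le> \<beta> * real n * real n * (d / real n)"
          using elim by (intro mult_right_mono) auto
        also have "\<dots> = \<beta> * d * real n" using elim by simp
        finally have "real (card (touching n Z)) * (d / real n) * (exp t - 1) \<le> \<beta> * d * real n * exp t"
          using t d \<beta> by (intro mult_mono[of _ "\<beta> * d * real n" "exp t - 1"]) auto
        also have "\<dots> = (\<beta> * d * exp t) * real n" by simp
        also have "\<dots> \<le> 1 * real n" using \<beta>(3) by (rule mult_right_mono) simp
        finally have "real (card (touching n Z)) * (d / real n) * (exp t - 1) \<le> real n" by simp
        moreover have "t * ?a n = 3 * real n" using t(2) by (metis mult.assoc)
        ultimately have "real (card (touching n Z)) * (d / real n) * (exp t - 1) - t * ?a n
            \<le> - 2 * real n" by linarith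
        then have "exp (real (card (touching n Z)) * (d / real n) * (exp t - 1) - t * ?a n)
            \<le> exp (- 2 * real n)" by (rule exp_le_cancel_iff[THEN iffD2])
        moreover have "touching n Z \<subseteq> vertex_pairs n" by (auto simp: touching_def)
        ultimately show ?thesis
          using prob_many_edges[of "d / real n" "touching n Z" n t "?a n"] elim t(1) by linarith
      qed
      have "{Y. \<not> (\<forall>Z\<in>?S n. (\<Sum>e\<in>touching n Z. Y e) < ?a n)} =
          (\<Union>Z\<in>?S n. {Y. ?a n \<le> (\<Sum>e\<in>touching n Z. Y e)})" by (auto simp: not_less)
      then have "graph_prob n (d / real n) {Y. \<not> (\<forall>Z\<in>?S n. (\<Sum>e\<in>touching n Z. Y e) < ?a n)} \<le>
          (\<Sum>Z\<in>?S n. graph_prob n (d / real n) {Y. ?a n \<le> (\<Sum>e\<in>touching n Z. Y e)})"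
        using measure_pmf.finite_measure_subadditive_finite[OF finS] by simp
      also have "\<dots> \<le> (\<Sum>Z\<in>?S n. exp (- 2 * real n))" by (intro sum_mono each)
      also have "\<dots> = real (card (?S n)) * exp (- 2 * real n)" by simp
      also have "\<dots> \<le> exp (real n) * exp (- 2 * real n)" using cardS by (intro mult_right_mono) auto
      also have "\<dots> = exp (- 1 * real n)" by (simp add: exp_add[symmetric])
      finally show ?case .
    qed
  qed
  have "overwhelming d (\<lambda>n Y. \<forall>Z. Z \<subseteq> {1..n} \<longrightarrow> real (card Z) \<le> \<beta> * real n \<longrightarrow>
    real (card (Z \<union> neighbours n Y Z)) \<le> \<beta>' * real n)"
  proof (rule overwhelming_mono[OF few], intro always_eventually allI impI)
    fix n and Y :: "nat set \<Rightarrow> real" and Z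
    assume Y: "\<forall>e. Y e \<in> {0, 1}" and few: "\<forall>Z\<in>?S n. (\<Sum>e\<in>touching n Z. Y e) < ?a n"
      and Z: "Z \<subseteq> {1..n}" "real (card Z) \<le> \<beta> * real n"
    have "real (card (neighbours n Y Z - Z)) \<le> ?a n"
    proof -
      have "(\<Sum>e\<in>touching n Z. Y e) < ?a n" using few Z by blast
      moreover have "real (card (neighbours n Y Z - Z)) \<le> (\<Sum>e\<in>touching n Z. Y e)"
        using Y Z(1) by (intro card_neighbours_diff_le) auto
      ultimately show ?thesis by linarith
    qed
    moreover have "\<beta> * real n \<le> ?a n" using \<beta>(2) by (intro mult_right_mono) auto
    moreover have "card (Z \<union> neighbours n Y Z) \<le> card Z + card (neighbours n Y Z - Z)"
      using card_Un_le[of Z "neighbours n Y Z - Z"] by simp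
    ultimately show "real (card (Z \<union> neighbours n Y Z)) \<le> \<beta>' * real n" using Z(2) by linarith
  qed
  then show ?thesis using \<beta>(1) by blast
qed

text \<open>Tolerances are chosen backwards by expansion: the bound \<open>\<beta>\<close> at radius
  \<open>t + 1\<close> asks for some bound \<open>\<beta>0\<close> at radius \<open>t\<close>, and
  so on down to radius 0, where the degree threshold \<open>M\<close> is fixed last.\<close>

lemma overwhelming_small_heavy_ball:
  assumes d: "d > 0"
  shows "\<beta> > 0 \<Longrightarrow>
    \<exists>M. overwhelming d (\<lambda>n Y. real (card (heavy_ball M n Y t)) \<le> \<beta> * real n)"
proof (induction t arbitrary: \<beta>)
  case 0
  then show ?case using overwhelming_few_heavy[OF d] by blast
next
  case (Suc t)
  obtain \<beta>0 where \<beta>0: "\<beta>0 > 0" "overwhelming d (\<lambda>n Y. \<forall>Z. Z \<subseteq> {1..n} \<longrightarrow>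
      real (card Z) \<le> \<beta>0 * real n \<longrightarrow> real (card (Z \<union> neighbours n Y Z)) \<le> \<beta> * real n)"
    using overwhelming_expansion[OF d Suc.prems] by blast
  obtain M where "overwhelming d (\<lambda>n Y. real (card (heavy_ball M n Y t)) \<le> \<beta>0 * real n)"
    using Suc.IH[OF \<beta>0(1)] by blast
  from overwhelming_conj[OF this \<beta>0(2)]
  have "overwhelming d (\<lambda>n Y. real (card (heavy_ball M n Y (Suc t))) \<le> \<beta> * real n)"
    by (rule overwhelming_mono) (use heavy_ball_subset in auto)
  then show ?case by blast
qed

subsection \<open>Edges inside blocks\<close>

text \<open>Distinct members of one residue class modulo \<open>R\<close> have different quotients
  by \<open>R\<close>, so each class has at most \<open>n div R + 1\<close> members.\<close>

lemma card_block_pairs_le: "card (block_pairs R n) \<le> n * (n div R + 1)"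
proof -
  let ?C = "\<lambda>i. {j\<in>{1..n}. j mod R = i mod R}"
  have C: "card (?C i) \<le> n div R + 1" for i
  proof -
    have "inj_on (\<lambda>j. j div R) (?C i)"
      by (rule inj_onI) (metis (mono_tags, lifting) div_mult_mod_eq mem_Collect_eq)
    moreover have "(\<lambda>j. j div R) ` ?C i \<subseteq> {0..n div R}" by (auto intro: div_le_mono)
    ultimately have "card (?C i) \<le> card {0..n div R}" by (intro card_inj_on_le) auto
    then show ?thesis by simp
  qed
  have "block_pairs R n \<subseteq> (\<lambda>(i, j). {i, j}) ` (SIGMA i:{1..n}. ?C i)"
  proof
    fix e assume e: "e \<in> block_pairs R n"
    then obtain i j where "e = {i, j}" by (auto simp: block_pairs_def vertex_pairs_def card_2_iff)
    with e have "i \<in> {1..n}" "j \<in> {1..n}" "j mod R = i mod R"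
      unfolding block_pairs_def vertex_pairs_def by blast+
    then have "(i, j) \<in> (SIGMA i:{1..n}. ?C i)" by simp
    then show "e \<in> (\<lambda>(i, j). {i, j}) ` (SIGMA i:{1..n}. ?C i)"
      by (rule rev_image_eqI) (simp add: \<open>e = {i, j}\<close>)
  qed
  then have "card (block_pairs R n) \<le> card (SIGMA i:{1..n}. ?C i)"
    by (intro surj_card_le) auto
  also have "\<dots> = (\<Sum>i\<in>{1..n}. card (?C i))" by (intro card_SigmaI) auto
  also have "\<dots> \<le> (\<Sum>i\<in>{1..n}. n div R + 1)" by (intro sum_mono C)
  finally show ?thesis by simp
qed

lemma overwhelming_few_block_edges:
  assumes d: "d > 0" and \<tau>: "\<tau> > 0"
  shows "\<exists>R>0. overwhelming d (\<lambda>n Y. (\<Sum>e\<in>block_pairs R n. Y e) \<le> \<tau> * real n)"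
proof -
  \<comment> \<open>The mean number of edges inside blocks is at most \<open>2 * d / R * n\<close>.
    With \<open>t = 1\<close> the exponent is at most \<open>4 * d / R * n - \<tau> * n\<close>, and
    this \<open>R\<close> makes the first term at most half of the second.\<close>
  obtain R :: nat where "8 * d / \<tau> \<le> real R" using real_arch_simple by blast
  moreover from this have R: "R > 0" using d \<tau>
    by (metis divide_pos_pos gr0I linorder_not_less mult_pos_pos of_nat_0 zero_less_numeral)
  ultimately have R8: "4 * d / real R \<le> \<tau> / 2" using \<tau> by (simp add: field_simps)
  have "overwhelming d (\<lambda>n Y. (\<Sum>e\<in>block_pairs R n. Y e) \<le> \<tau> * real n)"
  proof (rule overwhelmingI)
    show "\<tau> / 2 > 0" using \<tau> by simp
    show "\<forall>\<^sub>F n in sequentially. graph_prob n (d / real n)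
        {Y. \<not> (\<Sum>e\<in>block_pairs R n. Y e) \<le> \<tau> * real n} \<le> exp (- (\<tau> / 2) * real n)"
      using eventually_edge_prob[OF d zero_less_one] eventually_ge_at_top[of R]
    proof eventually_elim
      case (elim n)
      let ?F = "block_pairs R n"
      \<comment> \<open>For \<open>n\<close> at least \<open>R\<close>, doubling
        \<open>n / R\<close> absorbs the summand 1 in the class size.\<close>
      have "1 \<le> real n / real R" using elim R by simp
      then have "real (n div R + 1) \<le> 2 * (real n / real R)"
        using of_nat_div_le_of_nat[of n R, where 'a = real] by simp
      then have "real n * real (n div R + 1) \<le> real n * (2 * (real n / real R))"
        by (intro mult_left_mono) auto
      moreover have "real (card ?F) \<le> real n * real (n div R + 1)"
        using card_block_pairs_le[of R n] by (metis of_nat_mono of_nat_mult)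
      ultimately have "real (card ?F) \<le> real n * (2 * (real n / real R))" by linarith
      then have "real (card ?F) * (d / real n) \<le> real n * (2 * (real n / real R)) * (d / real n)"
        using elim by (intro mult_right_mono) auto
      also have "\<dots> = 2 * d / real R * real n" using elim by simp
      finally have "real (card ?F) * (d / real n) * (exp 1 - 1) \<le> 2 * d / real R * real n * 2"
        using exp_le d by (intro mult_mono[of _ "2 * d / real R * real n" "exp 1 - 1"]) auto
      also have "\<dots> = (4 * d / real R) * real n" by simp
      also have "\<dots> \<le> \<tau> / 2 * real n" using R8 by (intro mult_right_mono) auto
      finally have "real (card ?F) * (d / real n) * (exp 1 - 1) - 1 * (\<tau> * real n)
          \<le> - (\<tau> / 2) * real n" by linarith
      then have "exp (real (card ?F) * (d / real n) * (exp 1 - 1) - 1 * (\<tau> * real n))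
          \<le> exp (- (\<tau> / 2) * real n)" by (rule exp_le_cancel_iff[THEN iffD2])
      moreover have "?F \<subseteq> vertex_pairs n" by (auto simp: block_pairs_def)
      moreover have "graph_prob n (d / real n) {Y. \<not> (\<Sum>e\<in>?F. Y e) \<le> \<tau> * real n} \<le>
          graph_prob n (d / real n) {Y. \<tau> * real n \<le> (\<Sum>e\<in>?F. Y e)}"
        by (intro graph_prob_mono) auto
      ultimately show ?case
        using prob_many_edges[of "d / real n" ?F n 1 "\<tau> * real n"] elim by linarith
    qed
  qed
  then show ?thesis using R by blast
qed

subsection \<open>Dominating sets\<close>

lemma prob_dominating_le:
  assumes p: "0 \<le> p" "p \<le> 1" and U: "U \<subseteq> {1..n}"
  shows "graph_prob n p {Y. dominating n Y U} \<le> (1 - (1 - p) ^ card U) ^ (n - card U)"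
proof -
  let ?V = "{1..n} - U"
  \<comment> \<open>On 0/1 vectors, the indicator that \<open>i\<close> has no neighbour in
    \<open>U\<close>.\<close>
  let ?miss = "\<lambda>Y i. \<Prod>u\<in>U. 1 - Y {i, u}"
  have finU: "finite U" using U by (rule finite_subset) simp
  have miss: "0 \<le> ?miss Y i \<and> ?miss Y i \<le> 1" if "Y \<in> set_pmf (random_graph n p)" for Y i
  proof -
    have "0 \<le> 1 - Y e \<and> 1 - Y e \<le> 1" for e using set_random_graph[OF that, of e] by auto
    then show ?thesis by (auto intro!: prod_nonneg prod_le_1)
  qed
  have "graph_prob n p {Y. dominating n Y U} \<le>
      graph_expectation n p (\<lambda>Y. \<Prod>i\<in>?V. 1 - ?miss Y i)"
  proof (rule graph_prob_le_expectation)
    fix Y assume Y: "Y \<in> set_pmf (random_graph n p)"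
    then show "0 \<le> (\<Prod>i\<in>?V. 1 - ?miss Y i)" using miss by (intro prod_nonneg) auto
    assume "Y \<in> {Y. dominating n Y U}"
    then have "?miss Y i = 0" if "i \<in> ?V" for i
      using that finU by (force simp: dominating_def adjacent_def intro: prod_zero)
    then show "1 \<le> (\<Prod>i\<in>?V. 1 - ?miss Y i)" by simp
  qed
  also have "\<dots> = graph_expectation n p (\<lambda>Y. \<Sum>T\<in>Pow ?V. \<Prod>i\<in>T. - ?miss Y i)"
  proof -
    have "(\<Prod>i\<in>?V. 1 - ?miss Y i) = (\<Sum>T\<in>Pow ?V. \<Prod>i\<in>T. - ?miss Y i)"
      for Y :: "nat set \<Rightarrow> real"
      using prod_add[of ?V "\<lambda>i. - ?miss Y i" "\<lambda>_. 1"] by simp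
    then show ?thesis by simp
  qed
  also have "\<dots> = (\<Sum>T\<in>Pow ?V. graph_expectation n p (\<lambda>Y. \<Prod>i\<in>T. - ?miss Y i))"
    by (rule graph_expectation_sum)
  also have "\<dots> = (\<Sum>T\<in>Pow ?V. \<Prod>i\<in>T. - ((1 - p) ^ card U))"
  proof (rule sum.cong[OF refl])
    fix T assume T: "T \<in> Pow ?V"
    then have finT: "finite T" using finite_subset by auto
    let ?F = "(\<lambda>(i, u). {i, u}) ` (T \<times> U)"
    \<comment> \<open>\<open>T\<close> is disjoint from \<open>U\<close>, so a pair shows which of
      its ends is in \<open>T\<close>, and the product runs over distinct coordinates.\<close>
    have inj: "inj_on (\<lambda>(i, u). {i, u}) (T \<times> U)"
      using T by (auto intro!: inj_onI simp: doubleton_eq_iff)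
    have F: "?F \<subseteq> vertex_pairs n"
      using T U by (fastforce simp: vertex_pairs_def card_2_iff)
    \<comment> \<open>Agrees with \<open>1 - v\<close> on 0/1 values and is nonnegative everywhere,
      as \<open>graph_expectation_prod\<close> asks.\<close>
    let ?g = "\<lambda>v :: real. if v \<in> {0, 1} then 1 - v else 0"
    have "graph_expectation n p (\<lambda>Y. \<Prod>i\<in>T. - ?miss Y i) =
        graph_expectation n p (\<lambda>Y. (- 1) ^ card T * (\<Prod>e\<in>?F. ?g (Y e)))"
    proof (rule graph_expectation_cong)
      fix Y assume Y: "Y \<in> set_pmf (random_graph n p)"
      have "(\<Prod>i\<in>T. - ?miss Y i) = (\<Prod>i\<in>T. (- 1) * ?miss Y i)" by simp
      also have "\<dots> = (- 1) ^ card T * (\<Prod>i\<in>T. ?miss Y i)"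
        unfolding prod.distrib by simp
      also have "(\<Prod>i\<in>T. ?miss Y i) = (\<Prod>z\<in>T \<times> U. 1 - Y {fst z, snd z})"
        by (simp add: prod.cartesian_product case_prod_unfold)
      also have "\<dots> = (\<Prod>e\<in>?F. 1 - Y e)"
        by (subst prod.reindex[OF inj]) (simp add: case_prod_unfold)
      also have "\<dots> = (\<Prod>e\<in>?F. ?g (Y e))"
        using set_random_graph[OF Y] by (intro prod.cong) auto
      finally show "(\<Prod>i\<in>T. - ?miss Y i) = (- 1) ^ card T * (\<Prod>e\<in>?F. ?g (Y e))" .
    qed
    also have "\<dots> = (- 1) ^ card T * graph_expectation n p (\<lambda>Y. \<Prod>e\<in>?F. ?g (Y e))"
      by simp
    also have "graph_expectation n p (\<lambda>Y. \<Prod>e\<in>?F. ?g (Y e)) = (1 - p) ^ card ?F"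
      by (subst graph_expectation_prod[OF p F]) auto
    also have "card ?F = card U * card T"
      by (simp add: card_image[OF inj] card_cartesian_product)
    finally show "graph_expectation n p (\<lambda>Y. \<Prod>i\<in>T. - ?miss Y i) = (\<Prod>i\<in>T. - ((1 - p) ^ card U))"
      by (simp add: power_mult power_minus[of "(1 - p) ^ card U"])
  qed
  also have "\<dots> = (\<Prod>i\<in>?V. - ((1 - p) ^ card U) + 1)"
    by (subst prod_add) auto
  also have "\<dots> = (1 - (1 - p) ^ card U) ^ card ?V" by simp
  also have "card ?V = n - card U" using U finU by (simp add: card_Diff_subset)
  finally show ?thesis .
qed

lemma overwhelming_dominating_large:
  assumes d: "d \<ge> 1" and s: "0 \<le> s" "s \<le> 1 / 2"
    and key: "s * ln d + 1 / d < exp (- s * d) / 4"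
  shows "overwhelming d (\<lambda>n Y. \<forall>U. dominating n Y U \<longrightarrow> s * real n \<le> real (card U))"
proof (rule overwhelmingI)
  \<comment> \<open>\<open>q\<close> is a lower bound for the probability that \<open>U\<close>
    misses a given vertex; the factor 1/2 absorbs the error of replacing
    \<open>(1 - p) ^ card U\<close> by \<open>exp (- s * d)\<close>. A set dominates with
    probability at most \<open>exp (- q / 2 * n)\<close>, and \<open>key\<close> says that this
    beats the number of sets.\<close>
  define q where "q = exp (- s * d) / 2"
  have q: "q > 0" by (simp add: q_def)
  show "q / 2 - (s * ln d + 1 / d) > 0" using key by (simp add: q_def)
  have "\<forall>\<^sub>F n in sequentially. 4 * d\<^sup>2 * s \<le> real n" by real_asymp
  moreover have "\<forall>\<^sub>F n in sequentially. n > 0 \<and> 0 \<le> d / real n \<and> d / real n \<le> 1 / 2"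
    using d by (intro eventually_edge_prob) auto
  ultimately show "\<forall>\<^sub>F n in sequentially. graph_prob n (d / real n)
      {Y. \<not> (\<forall>U. dominating n Y U \<longrightarrow> s * real n \<le> real (card U))} \<le>
      exp (- (q / 2 - (s * ln d + 1 / d)) * real n)"
  proof eventually_elim
    case (elim n)
    define p where "p = d / real n"
    have p: "0 \<le> p" "p \<le> 1 / 2" "p * real n = d" and n: "n > 0" "4 * d\<^sup>2 * s \<le> real n"
      using elim by (auto simp: p_def)
    let ?S = "{U. U \<subseteq> {1..n} \<and> real (card U) < s * real n}"
    have finS: "finite ?S" by (rule finite_subset[of _ "Pow {1..n}"]) auto
    have each: "graph_prob n p {Y. dominating n Y U} \<le> exp (- q / 2 * real n)" if U: "U \<in> ?S" for U
    proof -
      \<comment> \<open>As \<open>s\<close> is at most 1/2, at least \<open>n / 2\<close> vertices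
        remain outside \<open>U\<close>.\<close>
      have sn: "s * real n \<le> real n / 2" using mult_right_mono[OF s(2), of "real n"] by simp
      then have cU: "card U \<le> n" "real n / 2 \<le> real (n - card U)" using U by auto
      \<comment> \<open>With \<open>n\<close> at least \<open>4 * d^2 * s\<close>, the second-order
        term in the lower bound for \<open>ln (1 - p)\<close> contributes at most 1/2 in
        total.\<close>
      have "p * d * s \<le> 1 / 4"
        using n by (simp add: p_def field_simps power2_eq_square)
      moreover have "(p + 2 * p\<^sup>2) * (s * real n) = s * (p * real n) + 2 * (p * (p * real n) * s)"
        by (simp add: power2_eq_square algebra_simps)
      ultimately have "(p + 2 * p\<^sup>2) * (s * real n) \<le> s * d + 1 / 2"
        unfolding p(3) by linarith
      moreover have "(p + 2 * p\<^sup>2) * real (card U) \<le> (p + 2 * p\<^sup>2) * (s * real n)"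
        using U p by (intro mult_left_mono) auto
      ultimately have "- s * d - 1 / 2 \<le> real (card U) * (- p - 2 * p\<^sup>2)" by (simp add: algebra_simps)
      also have "\<dots> \<le> real (card U) * ln (1 - p)"
        using ln_one_minus_pos_lower_bound[OF p(1,2)] by (intro mult_left_mono) auto
      finally have "exp (- s * d - 1 / 2) \<le> exp (real (card U) * ln (1 - p))" by simp
      also have "\<dots> = (1 - p) ^ card U" using p by (simp add: exp_of_nat_mult)
      finally have "exp (- s * d) * exp (- 1 / 2) \<le> (1 - p) ^ card U" by (simp flip: exp_add)
      moreover have "exp (- s * d) * (1 / 2) \<le> exp (- s * d) * exp (- 1 / 2)"
        using exp_ge_add_one_self[of "- 1 / 2"] by (intro mult_left_mono) auto
      ultimately have "exp (- s * d) * (1 / 2) \<le> (1 - p) ^ card U" by (rule order_trans[rotated])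
      then have "q \<le> (1 - p) ^ card U" by (simp add: q_def)
      then have "1 - (1 - p) ^ card U \<le> exp (- q)" using exp_ge_add_one_self[of "- q"] by linarith
      moreover have "0 \<le> 1 - (1 - p) ^ card U" using p by (simp add: power_le_one)
      ultimately have "(1 - (1 - p) ^ card U) ^ (n - card U) \<le> exp (- q) ^ (n - card U)"
        by (intro power_mono) auto
      also have "\<dots> = exp (- q * real (n - card U))" by (simp add: exp_of_nat_mult[symmetric] mult_ac)
      also have "\<dots> \<le> exp (- q * (real n / 2))" using cU q by simp
      finally show ?thesis using prob_dominating_le[of p U n] p U by simp
    qed
    \<comment> \<open>Sets of size below \<open>s n\<close> are counted with weight \<open>d powr (s n - card U) \<ge> 1\<close>.\<close>
    have "real (card ?S) = (\<Sum>U\<in>?S. 1)" by simp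
    also have "\<dots> \<le> (\<Sum>U\<in>?S. exp (s * real n * ln d) * (1 / d) ^ card U)"
    proof (rule sum_mono)
      fix U assume "U \<in> ?S"
      then have "0 \<le> (s * real n - real (card U)) * ln d" using d by simp
      then have "1 \<le> exp (s * real n * ln d - real (card U) * ln d)" by (simp add: algebra_simps)
      also have "\<dots> = exp (s * real n * ln d) / d ^ card U" using d by (simp add: exp_diff exp_of_nat_mult)
      finally show "1 \<le> exp (s * real n * ln d) * (1 / d) ^ card U" by (simp add: power_one_over)
    qed
    also have "\<dots> \<le> (\<Sum>U\<in>Pow {1..n}. exp (s * real n * ln d) * (1 / d) ^ card U)"
      using d by (intro sum_mono2) auto
    also have "\<dots> = exp (s * real n * ln d) * (\<Sum>U\<in>Pow {1..n}. (\<Prod>i\<in>U. 1 / d) * (\<Prod>i\<in>{1..n} - U. 1))"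
      by (simp add: sum_distrib_left)
    \<comment> \<open>The weighted sum over all subsets factorises over the vertices.\<close>
    also have "\<dots> = exp (s * real n * ln d) * (1 / d + 1) ^ n"
      by (subst prod_add[symmetric]) auto
    also have "\<dots> \<le> exp (s * real n * ln d) * exp (1 / d) ^ n"
      using d exp_ge_add_one_self[of "1 / d"] by (intro mult_left_mono power_mono) (auto simp: add.commute)
    also have "\<dots> = exp ((s * ln d + 1 / d) * real n)"
      by (simp add: exp_of_nat_mult[symmetric] exp_add[symmetric] algebra_simps)
    finally have cardS: "real (card ?S) \<le> exp ((s * ln d + 1 / d) * real n)" .
    have "{Y. \<not> (\<forall>U. dominating n Y U \<longrightarrow> s * real n \<le> real (card U))} \<subseteq>
        (\<Union>U\<in>?S. {Y. dominating n Y U})" by (auto simp: not_le dominating_def)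
    then have "graph_prob n p {Y. \<not> (\<forall>U. dominating n Y U \<longrightarrow> s * real n \<le> real (card U))} \<le>
        graph_prob n p (\<Union>U\<in>?S. {Y. dominating n Y U})"
      by (intro measure_pmf.finite_measure_mono) auto
    also have "\<dots> \<le> (\<Sum>U\<in>?S. graph_prob n p {Y. dominating n Y U})"
      using measure_pmf.finite_measure_subadditive_finite[OF finS] by simp
    also have "\<dots> \<le> (\<Sum>U\<in>?S. exp (- q / 2 * real n))" by (intro sum_mono each)
    also have "\<dots> = real (card ?S) * exp (- q / 2 * real n)" by simp
    also have "\<dots> \<le> exp ((s * ln d + 1 / d) * real n) * exp (- q / 2 * real n)"
      using cardS by (intro mult_right_mono) auto
    also have "\<dots> = exp (- (q / 2 - (s * ln d + 1 / d)) * real n)"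
      by (simp add: exp_add[symmetric] algebra_simps)
    finally show ?case by (simp add: p_def)
  qed
qed

subsection \<open>Moments\<close>

text \<open>Every \<open>a j\<close> with \<open>y j = 1\<close> is at most their maximum
  \<open>m\<close>, and \<open>m ^ r\<close> is a single term of the last sum. This separates the
  number of active terms from their values, so that independence can be used.\<close>

lemma sum_power_le:
  fixes y a :: "'a \<Rightarrow> real"
  assumes J: "finite J" and y: "\<And>j. j \<in> J \<Longrightarrow> y j \<in> {0, 1}" and a: "\<And>j. j \<in> J \<Longrightarrow> 0 \<le> a j" and r: "0 < r"
  shows "(\<Sum>j\<in>J. y j * a j) ^ r \<le> (\<Sum>j\<in>J. y j) ^ r * (\<Sum>j\<in>J. y j * a j ^ r)"
proof (cases "\<exists>j\<in>J. y j = 1")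
  case False
  then have "y j = 0" if "j \<in> J" for j using y[OF that] that by auto
  then show ?thesis using r by (simp add: zero_power)
next
  case True
  let ?S = "{j\<in>J. y j = 1}"
  define m where "m = Max (a ` ?S)"
  have S: "finite (a ` ?S)" "a ` ?S \<noteq> {}" using True J by auto
  obtain k where k: "k \<in> ?S" "m = a k" using Max_in[OF S] unfolding m_def by auto
  have y0: "0 \<le> y j" if "j \<in> J" for j using y[OF that] by auto
  have "y j * a j \<le> y j * m" if "j \<in> J" for j
    using y[OF that] Max_ge[OF S(1)] that unfolding m_def by auto
  then have "(\<Sum>j\<in>J. y j * a j) \<le> (\<Sum>j\<in>J. y j) * m"
    unfolding sum_distrib_right by (rule sum_mono)
  then have "(\<Sum>j\<in>J. y j * a j) ^ r \<le> ((\<Sum>j\<in>J. y j) * m) ^ r"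
    using y0 a by (intro power_mono sum_nonneg) auto
  also have "\<dots> = (\<Sum>j\<in>J. y j) ^ r * (y k * a k ^ r)" using k by (simp add: power_mult_distrib)
  also have "\<dots> \<le> (\<Sum>j\<in>J. y j) ^ r * (\<Sum>j\<in>J. y j * a j ^ r)"
    using k J y0 a
    by (intro mult_left_mono zero_le_power sum_nonneg member_le_sum[of k J "\<lambda>j. y j * a j ^ r"]) auto
  finally show ?thesis .
qed

text \<open>Compare with \<open>(1 + x / r) ^ r\<close>, which is at most
  \<open>exp x\<close>.\<close>

lemma power_le_exp:
  fixes x :: real
  assumes "0 \<le> x"
  shows "x ^ r \<le> real r ^ r * exp x"
proof (cases "r = 0")
  case False
  have "(x / real r) ^ r \<le> (1 + x / real r) ^ r" using assms by (intro power_mono) auto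
  also have "\<dots> \<le> exp x"
    using assms False by (intro exp_ge_one_plus_x_over_n_power_n) auto
  finally show ?thesis using False by (simp add: power_divide field_simps)
qed (use assms in simp)

text \<open>The mean degree is at most \<open>d\<close> and \<open>exp 1 - 1\<close> at most 2, so
  the exponential moment is at most \<open>exp (2 * d)\<close>, uniformly in
  \<open>n\<close>.\<close>

lemma degree_moment_le:
  assumes d: "0 \<le> d" and p: "d / real n \<le> 1" and i: "i \<in> {1..n}"
  shows "graph_expectation n (d / real n) (\<lambda>Y. (\<Sum>e\<in>touching n {i}. Y e) ^ r) \<le> real r ^ r * exp (2 * d)"
proof -
  let ?F = "touching n {i}"
  let ?E = "graph_expectation n (d / real n)"
  have n: "0 < n" using i by auto
  have F: "?F \<subseteq> vertex_pairs n" by (auto simp: touching_def)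
  have "?E (\<lambda>Y. (\<Sum>e\<in>?F. Y e) ^ r) \<le> ?E (\<lambda>Y. real r ^ r * exp (1 * (\<Sum>e\<in>?F. Y e)))"
  proof (rule graph_expectation_mono)
    fix Y assume Y: "Y \<in> set_pmf (random_graph n (d / real n))"
    have "0 \<le> Y e" for e using set_random_graph[OF Y, of e] by auto
    then show "(\<Sum>e\<in>?F. Y e) ^ r \<le> real r ^ r * exp (1 * (\<Sum>e\<in>?F. Y e))"
      using power_le_exp[of "\<Sum>e\<in>?F. Y e" r] by (simp add: sum_nonneg)
  qed
  also have "\<dots> = real r ^ r * ?E (\<lambda>Y. exp (1 * (\<Sum>e\<in>?F. Y e)))" by simp
  also have "\<dots> \<le> real r ^ r * exp (real (card ?F) * (d / real n) * (exp 1 - 1))"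
    using d p F by (intro mult_left_mono mgf_edges_le) auto
  also have "\<dots> \<le> real r ^ r * exp (2 * d)"
  proof -
    have "card ?F \<le> n" using card_touching_le[of "{i}" n] i by simp
    then have "real (card ?F) * (d / real n) \<le> real n * (d / real n)"
      using d by (intro mult_right_mono) auto
    then have "real (card ?F) * (d / real n) \<le> d" using n by simp
    then have "real (card ?F) * (d / real n) * (exp 1 - 1) \<le> d * 2"
      using exp_le d by (intro mult_mono[of _ d "exp 1 - 1"]) auto
    then show ?thesis by (intro mult_left_mono) auto
  qed
  finally show ?thesis .
qed

lemma one_plus_power_le:
  fixes x :: real
  assumes "0 \<le> x"
  shows "(1 + x) ^ r \<le> 2 ^ r * (1 + x ^ r)"
proof -
  have "(1 + x) ^ r \<le> (2 * max 1 x) ^ r" using assms by (intro power_mono) auto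
  also have "\<dots> = 2 ^ r * max 1 x ^ r" by (rule power_mult_distrib)
  also have "max 1 x ^ r \<le> 1 + x ^ r" using assms by (auto simp: max_def)
  finally show ?thesis by simp
qed

text \<open>The values at earlier vertices are independent of the edges at \<open>i\<close>.\<close>

lemma weighted_degree_moment_le:
  assumes d: "0 \<le> d" "d / real n \<le> 1" and i: "i \<in> {1..n}" and r: "0 < r" and K: "0 \<le> K"
    and le: "\<And>j. j \<in> earlier R n i \<Longrightarrow>
      graph_expectation n (d / real n) (\<lambda>Y. \<bar>block_greedy R M n Y j\<bar> ^ r) \<le> K"
  shows "graph_expectation n (d / real n)
      (\<lambda>Y. (\<Sum>j\<in>earlier R n i. Y {i, j} * \<bar>block_greedy R M n Y j\<bar>) ^ r)
    \<le> K * (real (Suc r) ^ Suc r * exp (2 * d))"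
proof -
  let ?F = "touching n {i}"
  let ?E = "graph_expectation n (d / real n)"
  let ?J = "earlier R n i"
  let ?deg = "\<lambda>Y. \<Sum>e\<in>?F. Y e"
  let ?a = "\<lambda>Y j. \<bar>block_greedy R M n Y j\<bar>"
  have F: "?F \<subseteq> vertex_pairs n" by (auto simp: touching_def)
  have pair: "{i, j} \<in> ?F" if "j \<in> ?J" for j
  proof -
    have "i \<noteq> j" "j \<in> {1..n}" using that by (auto simp: earlier_def)
    then show ?thesis using i by (simp add: touching_def vertex_pairs_def)
  qed
  have row: "(\<Sum>j\<in>?J. Y {i, j}) \<le> ?deg Y \<and> 0 \<le> (\<Sum>j\<in>?J. Y {i, j})"
    if "\<And>e. Y e \<in> {0, 1}" for Y :: "nat set \<Rightarrow> real"
  proof -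
    have Y0: "0 \<le> Y e" for e using that[of e] by auto
    have "inj_on (\<lambda>j. {i, j}) ?J" by (auto intro!: inj_onI simp: doubleton_eq_iff)
    then have "(\<Sum>j\<in>?J. Y {i, j}) = (\<Sum>e\<in>(\<lambda>j. {i, j}) ` ?J. Y e)"
      by (simp add: sum.reindex)
    also have "\<dots> \<le> ?deg Y"
      using pair Y0 by (intro sum_mono2) (auto simp: touching_def)
    finally show ?thesis using Y0 by (simp add: sum_nonneg)
  qed
  have "?E (\<lambda>Y. (\<Sum>j\<in>?J. Y {i, j} * ?a Y j) ^ r) \<le>
      ?E (\<lambda>Y. \<Sum>j\<in>?J. (?deg Y ^ r * Y {i, j}) * ?a Y j ^ r)"
  proof (rule graph_expectation_mono)
    fix Y assume "Y \<in> set_pmf (random_graph n (d / real n))"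
    then have Y: "Y e \<in> {0, 1}" for e by (rule set_random_graph)
    have Y0: "0 \<le> Y e" for e using Y[of e] by auto
    have "(\<Sum>j\<in>?J. Y {i, j} * ?a Y j) ^ r \<le> (\<Sum>j\<in>?J. Y {i, j}) ^ r * (\<Sum>j\<in>?J. Y {i, j} * ?a Y j ^ r)"
      using r Y by (intro sum_power_le) auto
    also have "\<dots> \<le> ?deg Y ^ r * (\<Sum>j\<in>?J. Y {i, j} * ?a Y j ^ r)"
      using row[of Y, OF Y] Y0 by (intro mult_right_mono power_mono sum_nonneg) auto
    finally show "(\<Sum>j\<in>?J. Y {i, j} * ?a Y j) ^ r \<le> (\<Sum>j\<in>?J. (?deg Y ^ r * Y {i, j}) * ?a Y j ^ r)"
      by (simp add: sum_distrib_left mult.assoc)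
  qed
  also have "\<dots> = (\<Sum>j\<in>?J. ?E (\<lambda>Y. (?deg Y ^ r * Y {i, j}) * ?a Y j ^ r))"
    by (rule graph_expectation_sum)
  also have "\<dots> = (\<Sum>j\<in>?J. ?E (\<lambda>Y. ?deg Y ^ r * Y {i, j}) * ?E (\<lambda>Y. ?a Y j ^ r))"
  proof (intro sum.cong refl graph_expectation_mult_indep[OF F])
    fix j and Y Y' :: "nat set \<Rightarrow> real"
    assume j: "j \<in> ?J"
    show "?deg Y ^ r * Y {i, j} = ?deg Y' ^ r * Y' {i, j}"
      if "\<And>e. e \<in> ?F \<Longrightarrow> Y e = Y' e"
      using that pair[OF j] by (simp cong: sum.cong)
    show "?a Y j ^ r = ?a Y' j ^ r" if eq: "\<And>e. e \<in> vertex_pairs n - ?F \<Longrightarrow> Y e = Y' e"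
    proof -
      have "block_greedy R M n Y j = block_greedy R M n Y' j"
      proof (rule block_greedy_cong)
        show "j \<in> {1..n}" using j by (simp add: earlier_def)
        fix e assume e: "e \<in> vertex_pairs n" "\<And>a. a \<in> e \<Longrightarrow> a mod R \<le> j mod R"
        \<comment> \<open>All ends of \<open>e\<close> are in rounds up to that of \<open>j\<close>,
          which precedes the round of \<open>i\<close>.\<close>
        then have "i \<notin> e" using j by (force simp: earlier_def)
        then show "Y e = Y' e" using e(1) by (intro eq) (simp add: touching_def)
      qed
      then show ?thesis by simp
    qed
  qed
  also have "\<dots> \<le> (\<Sum>j\<in>?J. ?E (\<lambda>Y. ?deg Y ^ r * Y {i, j}) * K)"
  proof (intro sum_mono mult_left_mono le)
    fix j
    show "0 \<le> ?E (\<lambda>Y. ?deg Y ^ r * Y {i, j})"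
    proof (intro integral_nonneg_AE AE_pmfI)
      fix Y assume "Y \<in> set_pmf (random_graph n (d / real n))"
      then have Y: "Y e \<in> {0, 1}" for e by (rule set_random_graph)
      have "0 \<le> Y e" for e using Y[of e] by auto
      then show "0 \<le> ?deg Y ^ r * Y {i, j}" by (simp add: sum_nonneg)
    qed
  qed
  also have "\<dots> = K * ?E (\<lambda>Y. \<Sum>j\<in>?J. ?deg Y ^ r * Y {i, j})"
    unfolding graph_expectation_sum sum_distrib_left by (rule sum.cong[OF refl mult.commute])
  \<comment> \<open>Summing \<open>Y {i, j}\<close> over \<open>j\<close> costs one more factor of
    the degree, so the number of summands does not enter the bound.\<close>
  also have "\<dots> \<le> K * ?E (\<lambda>Y. ?deg Y ^ Suc r)"
  proof (intro mult_left_mono K graph_expectation_mono)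
    fix Y assume "Y \<in> set_pmf (random_graph n (d / real n))"
    then have Y: "Y e \<in> {0, 1}" for e by (rule set_random_graph)
    have "(\<Sum>j\<in>?J. ?deg Y ^ r * Y {i, j}) = ?deg Y ^ r * (\<Sum>j\<in>?J. Y {i, j})"
      by (simp add: sum_distrib_left)
    also have "\<dots> \<le> ?deg Y ^ r * ?deg Y"
      using row[of Y, OF Y] by (intro mult_left_mono zero_le_power) auto
    finally show "(\<Sum>j\<in>?J. ?deg Y ^ r * Y {i, j}) \<le> ?deg Y ^ Suc r" by (simp add: mult.commute)
  qed
  also have "\<dots> \<le> K * (real (Suc r) ^ Suc r * exp (2 * d))"
    using d i K by (intro mult_left_mono degree_moment_le)
  finally show ?thesis .
qed

text \<open>Induction over the rounds, for all exponents at once: the \<open>q\<close>-th moment in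
  one round is controlled by a moment of order \<open>M * q + 1\<close> in the earlier ones. The
  constant may grow with the number of rounds but not with \<open>n\<close>.\<close>

lemma block_greedy_moment_bounded:
  assumes d: "0 \<le> d"
  shows "\<exists>K\<ge>0. \<forall>n i. d / real n \<le> 1 \<longrightarrow> i \<in> {1..n} \<longrightarrow> i mod R < t \<longrightarrow>
    graph_expectation n (d / real n) (\<lambda>Y. \<bar>block_greedy R M n Y i\<bar> ^ q) \<le> K"
proof (induction t arbitrary: q)
  case 0
  then show ?case by auto
next
  case (Suc t)
  \<comment> \<open>\<open>root_poly\<close> grows like a power \<open>M\<close>, hence
    \<open>M * q\<close>; the successor keeps \<open>r\<close> positive when this product is
    0.\<close>
  define r where "r = Suc (M * q)"
  obtain K where K: "K \<ge> 0" "\<And>n i. d / real n \<le> 1 \<Longrightarrow> i \<in> {1..n} \<Longrightarrow> i mod R < t \<Longrightarrow>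
      graph_expectation n (d / real n) (\<lambda>Y. \<bar>block_greedy R M n Y i\<bar> ^ r) \<le> K"
    using Suc.IH[of r] by blast
  define L where "L = 2 ^ r * (1 + K * (real (Suc r) ^ Suc r * exp (2 * d)))"
  have "L \<ge> 0" using K(1) by (simp add: L_def)
  moreover have "graph_expectation n (d / real n) (\<lambda>Y. \<bar>block_greedy R M n Y i\<bar> ^ q) \<le> L"
    if n: "d / real n \<le> 1" and i: "i \<in> {1..n}" "i mod R < Suc t" for n i
  proof -
    let ?E = "graph_expectation n (d / real n)"
    let ?T = "\<lambda>Y. \<Sum>j\<in>earlier R n i. Y {i, j} * \<bar>block_greedy R M n Y j\<bar>"
    have "?E (\<lambda>Y. \<bar>block_greedy R M n Y i\<bar> ^ q) \<le> ?E (\<lambda>Y. 2 ^ r * (1 + ?T Y ^ r))"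
    proof (rule graph_expectation_mono)
      fix Y assume "Y \<in> set_pmf (random_graph n (d / real n))"
      then have Y: "Y e \<in> {0, 1}" for e by (rule set_random_graph)
      have Y0: "0 \<le> Y e" for e using Y[of e] by auto
      then have T: "0 \<le> ?T Y" by (intro sum_nonneg) simp
      let ?N = "\<Sum>j\<in>earlier R n i. Y {i, j} * block_greedy R M n Y j"
      have "\<bar>?N\<bar> \<le> (\<Sum>j\<in>earlier R n i. \<bar>Y {i, j} * block_greedy R M n Y j\<bar>)" by (rule sum_abs)
      also have "\<dots> = ?T Y" using Y0 by (simp add: abs_mult)
      finally have N: "\<bar>?N\<bar> \<le> ?T Y" .
      have "\<bar>block_greedy R M n Y i\<bar> \<le> (1 + \<bar>?N\<bar>) ^ M"
        by (subst block_greedy.simps) (rule abs_root_poly_le)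
      then have "\<bar>block_greedy R M n Y i\<bar> ^ q \<le> ((1 + \<bar>?N\<bar>) ^ M) ^ q"
        by (intro power_mono) auto
      also have "\<dots> = (1 + \<bar>?N\<bar>) ^ (M * q)" by (simp add: power_mult)
      also have "\<dots> \<le> (1 + ?T Y) ^ (M * q)" using N by (intro power_mono) auto
      also have "\<dots> \<le> (1 + ?T Y) ^ r" using T by (intro power_increasing) (auto simp: r_def)
      also have "\<dots> \<le> 2 ^ r * (1 + ?T Y ^ r)" using T by (rule one_plus_power_le)
      finally show "\<bar>block_greedy R M n Y i\<bar> ^ q \<le> 2 ^ r * (1 + ?T Y ^ r)" .
    qed
    also have "\<dots> = 2 ^ r * (1 + ?E (\<lambda>Y. ?T Y ^ r))" by simp
    also have "\<dots> \<le> L"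
    proof -
      have "?E (\<lambda>Y. ?T Y ^ r) \<le> K * (real (Suc r) ^ Suc r * exp (2 * d))"
        using d n i K by (intro weighted_degree_moment_le) (auto simp: r_def earlier_def)
      then show ?thesis unfolding L_def by (intro mult_left_mono add_left_mono) auto
    qed
    finally show ?thesis .
  qed
  ultimately show ?case by blast
qed

lemma block_greedy_second_moment:
  assumes d: "0 \<le> d" and R: "0 < R"
  shows "\<exists>K\<ge>0. \<forall>n. d / real n \<le> 1 \<longrightarrow>
    graph_expectation n (d / real n) (\<lambda>Y. (L2_set (block_greedy R M n Y) {1..n})\<^sup>2) \<le> K * real n"
proof -
  obtain K where K: "K \<ge> 0" "\<And>n i. d / real n \<le> 1 \<Longrightarrow> i \<in> {1..n} \<Longrightarrow> i mod R < R \<Longrightarrow>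
      graph_expectation n (d / real n) (\<lambda>Y. \<bar>block_greedy R M n Y i\<bar> ^ 2) \<le> K"
    using block_greedy_moment_bounded[OF d, of R R M 2] by blast
  have "graph_expectation n (d / real n) (\<lambda>Y. (L2_set (block_greedy R M n Y) {1..n})\<^sup>2) \<le> K * real n"
    if n: "d / real n \<le> 1" for n
  proof -
    have "graph_expectation n (d / real n) (\<lambda>Y. (L2_set (block_greedy R M n Y) {1..n})\<^sup>2) =
        (\<Sum>i\<in>{1..n}. graph_expectation n (d / real n) (\<lambda>Y. \<bar>block_greedy R M n Y i\<bar> ^ 2))"
      by (simp add: L2_set_def sum_nonneg graph_expectation_sum)
    also have "\<dots> \<le> (\<Sum>i\<in>{1..n}. K)" using n R by (intro sum_mono K(2)) auto
    finally show ?thesis by (simp add: mult.commute)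
  qed
  then show ?thesis using K(1) by blast
qed

subsection \<open>Choice of the parameters\<close>

text \<open>For the density \<open>(1 - \<epsilon> / 2) * (ln d / d)\<close> the exponential equals
  \<open>d powr (\<epsilon> / 2) / d\<close>, which eventually exceeds any multiple of
  \<open>(ln d)^2 / d\<close>.\<close>

lemma eventually_domination_threshold:
  fixes \<epsilon> :: real
  assumes "0 < \<epsilon>" "\<epsilon> < 1"
  shows "\<forall>\<^sub>F d in at_top. 2 \<le> d \<and> (1 - \<epsilon> / 2) * (ln d / d) \<le> 1 / 2 \<and>
    (1 - \<epsilon> / 2) * (ln d / d) * ln d + 1 / d < exp (- ((1 - \<epsilon> / 2) * (ln d / d)) * d) / 4"
proof (intro eventually_conj)
  show "\<forall>\<^sub>F d in at_top. 2 \<le> (d::real)" by (rule eventually_ge_at_top)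
  show "\<forall>\<^sub>F d in at_top. (1 - \<epsilon> / 2) * (ln d / d) \<le> 1 / 2" using assms by real_asymp
  have "\<forall>\<^sub>F d in at_top. (1 - \<epsilon> / 2) * (ln d / d) * ln d + 1 / d < d powr (\<epsilon> / 2) / d / 4"
    using assms by real_asymp
  then show "\<forall>\<^sub>F d in at_top. (1 - \<epsilon> / 2) * (ln d / d) * ln d + 1 / d
      < exp (- ((1 - \<epsilon> / 2) * (ln d / d)) * d) / 4"
    using eventually_gt_at_top[of 0]
  proof eventually_elim
    case (elim d)
    have "- ((1 - \<epsilon> / 2) * (ln d / d)) * d = \<epsilon> / 2 * ln d - ln d"
      using elim(2) by (simp add: field_simps)
    then have "exp (- ((1 - \<epsilon> / 2) * (ln d / d)) * d) = d powr (\<epsilon> / 2) / d"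
      using elim(2) by (simp add: exp_diff powr_def)
    then show ?case using elim(1) by simp
  qed
qed

theorem theorem1p4:
  shows "\<forall>\<epsilon>::real. \<epsilon> > 0 \<longrightarrow> (\<exists>dstar::real. dstar > 0 \<and>
    (\<forall>(d::real) (\<eta>::real). d \<ge> dstar \<and> \<eta> > 0 \<longrightarrow>
      (\<exists>(nstar::nat) (D::nat) (\<gamma>::real) (C::real).
         nstar > 0 \<and> D > 0 \<and> \<gamma> \<ge> 1 \<and> C > 0 \<and>
         (\<forall>n\<ge>nstar. \<forall>k \<delta>.
            k = (1 - \<epsilon>) * (ln d / d) * real n \<and> k > 0 \<and>
            \<delta> = exp (- C * real n powr (1/3)) \<longrightarrow>
            (\<exists>f. polynomial_map n D f \<and> optimizes_independent_set n d f k \<delta> \<gamma> \<eta>)))))"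
proof (intro allI impI)
  fix \<epsilon> :: real
  assume \<epsilon>: "\<epsilon> > 0"
  show "\<exists>dstar::real. dstar > 0 \<and>
    (\<forall>(d::real) (\<eta>::real). d \<ge> dstar \<and> \<eta> > 0 \<longrightarrow>
      (\<exists>(nstar::nat) (D::nat) (\<gamma>::real) (C::real).
         nstar > 0 \<and> D > 0 \<and> \<gamma> \<ge> 1 \<and> C > 0 \<and>
         (\<forall>n\<ge>nstar. \<forall>k \<delta>.
            k = (1 - \<epsilon>) * (ln d / d) * real n \<and> k > 0 \<and>
            \<delta> = exp (- C * real n powr (1/3)) \<longrightarrow>
            (\<exists>f. polynomial_map n D f \<and> optimizes_independent_set n d f k \<delta> \<gamma> \<eta>))))"
  proof (cases "\<epsilon> < 1")
    case False \<comment> \<open>vacuous, since then \<open>k \<le> 0\<close>\<close>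
    have "\<not> 0 < (1 - \<epsilon>) * (ln d / d) * real n" if "d \<ge> 1" for d n
    proof -
      have "(1 - \<epsilon>) * (ln d / d * real n) \<le> 0"
        using False that by (intro mult_nonpos_nonneg) auto
      then show ?thesis by (simp add: mult.assoc)
    qed
    then show ?thesis by (intro exI[of _ 1]) (auto intro!: exI[of _ "1::nat"] exI[of _ "1::real"])
  next
    case True
    obtain N where N: "\<And>d. d \<ge> N \<Longrightarrow> 2 \<le> d \<and> (1 - \<epsilon> / 2) * (ln d / d) \<le> 1 / 2 \<and>
        (1 - \<epsilon> / 2) * (ln d / d) * ln d + 1 / d < exp (- ((1 - \<epsilon> / 2) * (ln d / d)) * d) / 4"
      using eventually_domination_threshold[OF \<epsilon> True] unfolding eventually_at_top_linorder by blast
    show ?thesis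
    proof (intro exI[of _ "max 1 N"] conjI allI impI)
      fix d \<eta> :: real
      assume "max 1 N \<le> d \<and> 0 < \<eta>"
      then have "N \<le> d" and \<eta>: "0 < \<eta>" by auto
      \<comment> \<open>The target \<open>k\<close> is \<open>(1 - \<epsilon>) * l * n\<close>. The
        density \<open>s\<close> lies midway between \<open>(1 - \<epsilon>) * l\<close> and
        \<open>l\<close>, which leaves a margin of \<open>\<epsilon> / 2 * l\<close> for exceptional
        vertices.\<close>
      define l where "l = ln d / d"
      define s where "s = (1 - \<epsilon> / 2) * l"
      have d: "2 \<le> d" and s: "s \<le> 1 / 2" and key: "s * ln d + 1 / d < exp (- s * d) / 4"
        using N[OF \<open>N \<le> d\<close>] by (auto simp: s_def l_def)
      have l: "0 < l" using d by (simp add: l_def)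
      \<comment> \<open>The exceptional fraction must respect both the tolerance
        \<open>\<eta>\<close> of the rounding and the margin between \<open>s\<close> and the target
        density.\<close>
      define b where "b = min \<eta> (\<epsilon> / 2 * l)"
      have b: "0 < b" "b \<le> \<eta>" "b \<le> \<epsilon> / 2 * l" using \<eta> \<epsilon> l by (auto simp: b_def)
      have "0 \<le> s" using True \<epsilon> l by (simp add: s_def)
      then have dom: "overwhelming d (\<lambda>n Y. \<forall>U. dominating n Y U \<longrightarrow> s * real n \<le> real (card U))"
        using d s key by (intro overwhelming_dominating_large) auto
      \<comment> \<open>Block edges and the heavy ball both enter with factor 2, so each gets
        \<open>b / 4\<close>. The number of rounds is fixed first, since the radius of the ball, and
        with it \<open>M\<close>, depends on it.\<close>
      obtain R where R: "0 < R"
        and edges: "overwhelming d (\<lambda>n Y. (\<Sum>e\<in>block_pairs R n. Y e) \<le> b / 4 * real n)"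
        using overwhelming_few_block_edges[of d "b / 4"] d b(1) by auto
      obtain M where heavy: "overwhelming d (\<lambda>n Y. real (card (heavy_ball M n Y (Suc R))) \<le> b / 4 * real n)"
        using overwhelming_small_heavy_ball[of d "b / 4" "Suc R"] d b(1) by auto
      let ?f = "\<lambda>n. block_greedy R M n"
      have "overwhelming d (\<lambda>n Y. (1 - \<epsilon>) * l * real n \<le> real (card (rounded_set n \<eta> (?f n) Y)))"
      proof (rule overwhelming_mono[OF overwhelming_conj[OF dom overwhelming_conj[OF edges heavy]]],
          intro always_eventually allI impI, elim conjE)
        fix n and Y :: "nat set \<Rightarrow> real"
        assume Y: "\<forall>e. Y e \<in> {0, 1}"
          and dom: "\<forall>U. dominating n Y U \<longrightarrow> s * real n \<le> real (card U)"
          and edges: "(\<Sum>e\<in>block_pairs R n. Y e) \<le> b / 4 * real n"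
          and heavy: "real (card (heavy_ball M n Y (Suc R))) \<le> b / 4 * real n"
        have "s * real n - b * real n \<le> real (card (rounded_set n \<eta> (?f n) Y))"
        proof (rule card_rounded_set_block_greedy[OF _ R])
          show "2 * real (card (heavy_ball M n Y (Suc R))) + 2 * (\<Sum>e\<in>block_pairs R n. Y e) \<le> b * real n"
            using edges heavy by linarith
          show "b * real n \<le> \<eta> * real n" using b(2) by (rule mult_right_mono) simp
        qed (use Y dom in auto)
        moreover have "(1 - \<epsilon>) * l * real n \<le> (s - b) * real n"
          using b(3) by (intro mult_right_mono) (auto simp: s_def algebra_simps)
        ultimately show "(1 - \<epsilon>) * l * real n \<le> real (card (rounded_set n \<eta> (?f n) Y))"
          by (simp add: left_diff_distrib)
      qed
      then obtain c where c: "c > 0" and ev: "\<forall>\<^sub>F n in sequentially. graph_prob n (d / real n)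
          {Y. \<not> (1 - \<epsilon>) * l * real n \<le> real (card (rounded_set n \<eta> (?f n) Y))} \<le> exp (- c * real n)"
        unfolding overwhelming_def exp_small_def by blast
      have "\<forall>\<^sub>F n in sequentially. n > 0 \<and> 0 \<le> d / real n \<and> d / real n \<le> 1"
        using d by (intro eventually_edge_prob) auto
      with ev have "\<forall>\<^sub>F n in sequentially. n > 0 \<and> d / real n \<le> 1 \<and> graph_prob n (d / real n)
          {Y. \<not> (1 - \<epsilon>) * l * real n \<le> real (card (rounded_set n \<eta> (?f n) Y))} \<le> exp (- c * real n)"
        by eventually_elim auto
      then obtain n0 where n0: "\<And>n. n \<ge> n0 \<Longrightarrow> n > 0 \<and> d / real n \<le> 1 \<and> graph_prob n (d / real n)
          {Y. \<not> (1 - \<epsilon>) * l * real n \<le> real (card (rounded_set n \<eta> (?f n) Y))} \<le> exp (- c * real n)"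
        unfolding eventually_sequentially by blast
      obtain D where D: "\<And>n i. i \<in> {1..n} \<Longrightarrow> i mod R < R \<Longrightarrow>
          polynomial_function (vertex_pairs n) D (\<lambda>Y. block_greedy R M n Y i)"
        using block_greedy_polynomial[where t = R and R = R and M = M] by blast
      obtain K where K: "K \<ge> 0" "\<And>n. d / real n \<le> 1 \<Longrightarrow>
          graph_expectation n (d / real n) (\<lambda>Y. (L2_set (?f n Y) {1..n})\<^sup>2) \<le> K * real n"
        using block_greedy_second_moment[of d R M] d R by auto
      \<comment> \<open>Converts the moment bound \<open>K * n\<close> into a multiple of
        \<open>k\<close>.\<close>
      define \<gamma> where "\<gamma> = max 1 (K / ((1 - \<epsilon>) * l))"
      show "\<exists>(nstar::nat) (D::nat) (\<gamma>::real) (C::real).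
         nstar > 0 \<and> D > 0 \<and> \<gamma> \<ge> 1 \<and> C > 0 \<and>
         (\<forall>n\<ge>nstar. \<forall>k \<delta>.
            k = (1 - \<epsilon>) * (ln d / d) * real n \<and> k > 0 \<and>
            \<delta> = exp (- C * real n powr (1/3)) \<longrightarrow>
            (\<exists>f. polynomial_map n D f \<and> optimizes_independent_set n d f k \<delta> \<gamma> \<eta>))"
      proof (rule exI[of _ "max 1 n0"], rule exI[of _ "max 1 D"], rule exI[of _ \<gamma>], rule exI[of _ c],
          intro conjI allI impI)
        fix n k \<delta>
        assume "max 1 n0 \<le> n" and "k = (1 - \<epsilon>) * (ln d / d) * real n \<and> k > 0 \<and>
            \<delta> = exp (- c * real n powr (1/3))"
        then have n: "n \<ge> n0" "1 \<le> n" and k: "k = (1 - \<epsilon>) * l * real n"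
          and \<delta>: "\<delta> = exp (- c * real n powr (1/3))" by (auto simp: l_def)
        have "polynomial_map n (max 1 D) (?f n)"
          unfolding polynomial_map_def
        proof
          fix i assume "i \<in> {1..n}"
          then have "polynomial_function (vertex_pairs n) D (\<lambda>Y. block_greedy R M n Y i)"
            using R by (intro D) auto
          then have "polynomial_function (vertex_pairs n) (max 1 D) (\<lambda>Y. block_greedy R M n Y i)"
            by (rule polynomial_function_mono) simp
          then show "\<exists>q. mpoly_vars q \<subseteq> vertex_pairs n \<and> mpoly_degree_le q (max 1 D) \<and>
              (\<forall>x. block_greedy R M n x i = mpoly_eval q x)"
            unfolding polynomial_function_def .
        qed
        moreover have "optimizes_independent_set n d (?f n) k \<delta> \<gamma> \<eta>"
          unfolding optimizes_independent_set_def
        proof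
          have pos: "0 < (1 - \<epsilon>) * l" using True l by simp
          have "graph_expectation n (d / real n) (\<lambda>Y. (L2_set (?f n Y) {1..n})\<^sup>2) \<le> K * real n"
            using n0[OF n(1)] by (intro K(2)) auto
          also have "\<dots> = K / ((1 - \<epsilon>) * l) * k" using True l by (simp add: k)
          also have "\<dots> \<le> \<gamma> * k" using pos by (intro mult_right_mono) (auto simp: \<gamma>_def k)
          finally show "graph_expectation n (d / real n) (\<lambda>Y. (L2_set (?f n Y) {1..n})\<^sup>2) \<le> \<gamma> * k" .
          let ?S = "{Y. k \<le> real (card (rounded_set n \<eta> (?f n) Y))}"
          \<comment> \<open>The failure probability is exponentially small in \<open>n\<close>; for
            \<open>n\<close> at least 1 this implies the rate with
            \<open>n powr (1/3)\<close>.\<close>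
          have "real n powr (1/3) \<le> real n powr 1" using n(2) by (intro powr_mono) auto
          then have "exp (- c * real n) \<le> \<delta>" using c n(2) by (simp add: \<delta>)
          moreover have "graph_prob n (d / real n) (- ?S) \<le> exp (- c * real n)"
            using n0[OF n(1)] by (simp add: k Collect_neg_eq)
          moreover have "graph_prob n (d / real n) (- ?S) = 1 - graph_prob n (d / real n) ?S"
            using measure_pmf.prob_compl[of ?S "random_graph n (d / real n)"] by (simp add: Compl_eq_Diff_UNIV)
          ultimately show "1 - \<delta> \<le> graph_prob n (d / real n) ?S" by linarith
        qed
        ultimately show "\<exists>f. polynomial_map n (max 1 D) f \<and> optimizes_independent_set n d f k \<delta> \<gamma> \<eta>"
          by blast
      qed (use c in \<open>auto simp: \<gamma>_def\<close>)
    qed auto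
  qed
qed

end
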